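(* Let $\Omega,\Omega^*\subset\mathbb{R}$ be bounded domains (bounded open intervals), and let $U=\Omega\cup\Omega^*$. For any positive density functions $f^+\in C(\overline{\Omega})$ and $f^-\in C(\overline{\Omega^*})$ satisfying the normalized balance condition $\int_\Omega f^+\,dx=\int_{\Omega^*}f^-\,dx=1$, with $f:=f^+-f^-$, there exists a sequence $\{\bar u_k\}_{k\ge 1}$ of functions such that for every $k\in\mathbb{N}$, $k\geq 1$: (i) $\bar u_k$ satisfies the constraints $\bar u_k\in W_0^{1,\infty}(U)\cap C(\overline U)$, $\bar u_k=0$ on $\overline{\Omega\cap\Omega^*}$, and $\|\bar u_{k,x}\|_{L^\infty(U)}\le 1$; (ii) $\bar u_k$ is a solution, with Dirichlet boundary condition, of the Euler-Lagrange equation $$\big(e^{k(\bar u_{k,x}^2-1)/2}\,\bar u_{k,x}\big)_x+f=0\quad\text{in } U\setminus\overline{\Omega\cap\Omega^*};$$ (iii) $\bar u_k$ is a global minimizer of the approximation problem $(\mathscr{P}^{(k)})$, i.e. of $$I^{(k)}[w]=\int_U\Big(\tfrac1k e^{k(w_x^2-1)/2}-wf\Big)dx .$$ In particular, when $\Omega=(a,b)$, $\Omega^*=(c,d)$ and $\Omega\cap\Omega^*=\emptyset$, the functions $\bar u_k$ can be represented explicitly as $$\bar u_k(x)=\begin{cases}\displaystyle\int_a^x \frac{-F^+(t)+C_k}{E_k^{-1}\big((-F^+(t)+C_k)^2\big)}\,dt, & x\in[a,b],\\[3mm] \displaystyle\int_c^x \frac{F^-(t)-D_k}{E_k^{-1}\big((F^-(t)-D_k)^2\big)}\,dt,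 & x\in[c,d],\end{cases}$$ where $E_k(x)=x^2\ln(e\,x^{2/k})$, $E_k^{-1}$ is the inverse of $E_k$ (with values in $[e^{-k/2},1]$), $F^+(x)=\int_a^x f^+(t)\,dt$ for $x\in[a,b]$, $F^-(x)=\int_c^x f^-(t)\,dt$ for $x\in[c,d]$, and $\{C_k\}_k$, $\{D_k\}_k$ are number sequences in $(0,1)$.
   Context: Subscript $x$ denotes the (weak) derivative in $x$. The functions $f^+$ and $f^-$ are regarded as extended by zero to the rest of $U$, so that $f=f^+-f^-$ is defined on $U$. When $\Omega\cap\Omega^*=\emptyset$, $C(\overline U)$ is understood as $C(\overline\Omega)$ and $C(\overline{\Omega^*})$ respectively: the function is continuous on each of $\overline\Omega$, $\overline{\Omega^*}$ separately, and the Dirichlet condition is that it vanishes at the endpoints of each interval. The problem $(\mathscr{P}^{(k)})$ is to minimize $I^{(k)}[w]$ over functions $w$ satisfying the constraints $w\in W_0^{1,\infty}(U)\cap C(\overline U)$, $w=0$ on $\overline{\Omega\cap\Omega^*}$, $\|w_x\|_{L^\infty(U)}\le1$. The function $E_k$ is strictly increasing on $[e^{-k/2},1]$, with $E_k(e^{-k/2})=0$ and $E_k(1)=1$, and $E_k^{-1}:[0,1]\to[e^{-k/2},1]$ denotes the inverse of this restriction. *)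

theory Defs
  imports "HOL-Analysis.Analysis" "HOL-Probability.Essential_Supremum"
begin

definition smooth :: "(real \<Rightarrow> real) \<Rightarrow> bool" where
  "smooth \<phi> \<longleftrightarrow> (\<forall>n x. ((deriv ^^ n) \<phi>) field_differentiable at x)"

definition test_functions :: "real set \<Rightarrow> (real \<Rightarrow> real) set" where
  "test_functions V =
     {\<phi>. smooth \<phi> \<and> compact (closure {x. \<phi> x \<noteq> 0}) \<and> closure {x. \<phi> x \<noteq> 0} \<subseteq> V}"

definition locally_integrable :: "real set \<Rightarrow> (real \<Rightarrow> real) \<Rightarrow> bool" where
  "locally_integrable V g \<longleftrightarrow> (\<forall>K. compact K \<and> K \<subseteq> V \<longrightarrow> g absolutely_integrable_on K)"

definition has_weak_deriv :: "real set \<Rightarrow> (real \<Rightarrow> real) \<Rightarrow> (real \<Rightarrow> real) \<Rightarrow> bool" where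
  "has_weak_deriv V v g \<longleftrightarrow> locally_integrable V v \<and> locally_integrable V g \<and>
     (\<forall>\<phi>\<in>test_functions V.
        (LINT x:V|lebesgue. v x * deriv \<phi> x) = - (LINT x:V|lebesgue. g x * \<phi> x))"

text \<open>Weak derivatives on an open set are unique up to null sets, so any choice will do.\<close>

definition weak_deriv :: "real set \<Rightarrow> (real \<Rightarrow> real) \<Rightarrow> real \<Rightarrow> real" where
  "weak_deriv V v = (SOME g. has_weak_deriv V v g)"

definition Linf_norm :: "real set \<Rightarrow> (real \<Rightarrow> real) \<Rightarrow> ereal" where
  "Linf_norm V g = esssup (lebesgue_on V) (\<lambda>x. ereal \<bar>g x\<bar>)"

definition Linf :: "real set \<Rightarrow> (real \<Rightarrow> real) set" where
  "Linf V = {g. g \<in> borel_measurable (lebesgue_on V) \<and> Linf_norm V g < \<infinity>}"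

definition W1inf :: "real set \<Rightarrow> (real \<Rightarrow> real) set" where
  "W1inf V = {v. v \<in> Linf V \<and> (\<exists>g\<in>Linf V. has_weak_deriv V v g)}"

text \<open>
  Vanishing boundary values, expressed through the continuous representative. (The norm closure
  of the test functions in \<open>W1inf V\<close> is a smaller space: it consists of continuously
  differentiable functions.)
\<close>

definition W0_1inf :: "real set \<Rightarrow> (real \<Rightarrow> real) set" where
  "W0_1inf V = {v \<in> W1inf V. \<exists>r. continuous_on (closure V) r \<and> (\<forall>x\<in>frontier V. r x = 0) \<and>
                  (AE x in lebesgue_on V. v x = r x)}"

text \<open>
  Here \<open>A\<close> and \<open>B\<close> are the two domains. If they are disjoint, then
  \<open>frontier (A \<union> B)\<close> consists of the endpoints of both intervals, also when the intervals
  share an endpoint, and continuity on \<open>closure (A \<union> B)\<close> is continuity on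
  \<open>closure A\<close> and on \<open>closure B\<close>.
\<close>

definition admissible :: "real set \<Rightarrow> real set \<Rightarrow> (real \<Rightarrow> real) set" where
  "admissible A B =
     {w. w \<in> W0_1inf (A \<union> B) \<and> continuous_on (closure (A \<union> B)) w \<and>
         (\<forall>x\<in>closure (A \<inter> B). w x = 0) \<and>
         Linf_norm (A \<union> B) (weak_deriv (A \<union> B) w) \<le> 1}"

definition source ::
    "real set \<Rightarrow> real set \<Rightarrow> (real \<Rightarrow> real) \<Rightarrow> (real \<Rightarrow> real) \<Rightarrow> real \<Rightarrow> real" where
  "source A B fp fm x =
     (if x \<in> closure A then fp x else 0) - (if x \<in> closure B then fm x else 0)"

definition energy ::
    "nat \<Rightarrow> real set \<Rightarrow> (real \<Rightarrow> real) \<Rightarrow> (real \<Rightarrow> real) \<Rightarrow> real" where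
  "energy k V f w =
     (LINT x:V|lebesgue. 1 / real k * exp (real k * ((weak_deriv V w x)\<^sup>2 - 1) / 2) - w x * f x)"

text \<open>
  The equation on \<open>V\<close>, in the sense of weak derivatives, for a function \<open>u\<close>
  given on the larger open set \<open>U\<close>, with zero boundary values on \<open>V\<close>.
\<close>

definition euler_lagrange_solution ::
    "nat \<Rightarrow> real set \<Rightarrow> real set \<Rightarrow> (real \<Rightarrow> real) \<Rightarrow> (real \<Rightarrow> real) \<Rightarrow> bool" where
  "euler_lagrange_solution k U V f u \<longleftrightarrow>
     has_weak_deriv V
       (\<lambda>x. exp (real k * ((weak_deriv U u x)\<^sup>2 - 1) / 2) * weak_deriv U u x) (\<lambda>x. - f x) \<and>
     (\<forall>x\<in>frontier V. u x = 0)"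

definition E :: "nat \<Rightarrow> real \<Rightarrow> real" where
  "E k x = x\<^sup>2 * ln (exp 1 * x powr (2 / real k))"

definition E_inv :: "nat \<Rightarrow> real \<Rightarrow> real" where
  "E_inv k = the_inv_into {exp (- real k / 2)..1} (E k)"

end

(* At the level of fluxes the problem is explicit. On a component (p, q) of the complement of the
   closed overlap, the equation says that the flux exp (k (u_x^2 - 1) / 2) u_x is a constant minus
   the primitive of f; since f has a sign there and mass at most one, the flux can be kept in
   [-1, 1], where it determines the slope u_x in [-1, 1], and the intermediate value theorem picks
   the constant for which u vanishes at both ends. Extending u by zero gives an admissible function.
   It is a minimizer by convexity of the integrand: the first variation in the direction w - u is,
   on each component, an integration by parts of the flux against w - u, which vanishes at the ends.
   That step needs the fundamental theorem of calculus for weak derivatives, obtained by testing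
   with smooth approximations of indicator functions of intervals. *)

theory Submission
  imports Defs
begin

section \<open>Smooth functions\<close>

text \<open>Two obstacles shape the proof. First, \<open>weak_deriv\<close> is an arbitrary choice
  among representatives that agree only up to null sets, and the derivative of a competitor is
  merely bounded and measurable. Integrals are therefore moved to convenient representatives, and
  integration by parts must allow a factor that is only the indefinite integral of an integrable
  function. Second, the configuration varies: two components when the domains are disjoint, possibly
  with a common end, and between zero and two when they overlap. The analysis is therefore done for
  a finite family of disjoint open intervals. What it uses about their ends is that they lie outside
  the union: there the solution vanishes by construction, and a competitor vanishes because such an
  end lies in the closed overlap or on the frontier. This removes boundary terms even where a test
  function on the whole domain is nonzero at such an end.\<close>

lemma smooth_coinduct:
  assumes "f \<in> F"
    and F: "\<And>f x. f \<in> F \<Longrightarrow> f field_differentiable at x" "\<And>f. f \<in> F \<Longrightarrow> deriv f \<in> F"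
  shows "smooth f"
proof -
  have "(deriv ^^ n) f \<in> F" for n
    by (induction n) (auto intro: assms)
  then show ?thesis
    using F(1) by (auto simp: smooth_def)
qed

lemma smooth_imp_field_differentiable: "smooth f \<Longrightarrow> f field_differentiable at x"
  unfolding smooth_def by (metis funpow_0)

lemma smooth_imp_DERIV: "smooth f \<Longrightarrow> (f has_field_derivative deriv f x) (at x)"
  by (simp add: DERIV_deriv_iff_field_differentiable smooth_imp_field_differentiable)

lemma smooth_deriv: "smooth f \<Longrightarrow> smooth (deriv f)"
  unfolding smooth_def by (metis comp_apply funpow_Suc_right)

lemma smooth_if_smooth_deriv:
  assumes "\<And>x. f field_differentiable at x" "smooth (deriv f)"
  shows "smooth f"
  unfolding smooth_def
proof (intro allI)
  fix n x
  show "(deriv ^^ n) f field_differentiable at x"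
    using assms by (cases n) (auto simp: smooth_def funpow_Suc_right simp del: funpow.simps)
qed

lemma smooth_continuous_on: "smooth f \<Longrightarrow> continuous_on S f"
  using smooth_imp_DERIV DERIV_continuous_on has_field_derivative_at_within by blast

lemma smooth_const: "smooth (\<lambda>x. c)"
  by (rule smooth_coinduct[of _ "range (\<lambda>c x. c)"]) auto

text \<open>\<open>smooth_coinduct\<close> needs a family that \<open>deriv\<close> maps into
  itself. The derivative of a product is a sum of products, so sums and products have to be closed
  off together.\<close>

inductive_set smooth_alg :: "(real \<Rightarrow> real) set" where
  base: "smooth f \<Longrightarrow> f \<in> smooth_alg"
| add: "f \<in> smooth_alg \<Longrightarrow> g \<in> smooth_alg \<Longrightarrow> (\<lambda>x. f x + g x) \<in> smooth_alg"
| mult: "f \<in> smooth_alg \<Longrightarrow> g \<in> smooth_alg \<Longrightarrow> (\<lambda>x. f x * g x) \<in> smooth_alg"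

lemma smooth_alg_deriv:
  "f \<in> smooth_alg \<Longrightarrow> (\<forall>x. f field_differentiable at x) \<and> deriv f \<in> smooth_alg"
proof (induction rule: smooth_alg.induct)
  case (base f)
  then show ?case
    by (auto simp: smooth_imp_field_differentiable smooth_deriv intro: smooth_alg.base)
next
  case (add f g)
  have "((\<lambda>x. f x + g x) has_field_derivative deriv f x + deriv g x) (at x)" for x
    using add.IH by (intro DERIV_add) (auto simp: DERIV_deriv_iff_field_differentiable)
  then have "\<forall>x. (\<lambda>x. f x + g x) field_differentiable at x"
    and "deriv (\<lambda>x. f x + g x) = (\<lambda>x. deriv f x + deriv g x)"
    using DERIV_imp_deriv field_differentiable_def by blast+
  then show ?case
    using smooth_alg.add[of "deriv f" "deriv g"] add.IH by simp
next
  case (mult f g)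
  have "((\<lambda>x. f x * g x) has_field_derivative deriv f x * g x + deriv g x * f x) (at x)" for x
    using mult.IH by (intro DERIV_mult) (auto simp: DERIV_deriv_iff_field_differentiable)
  then have "\<forall>x. (\<lambda>x. f x * g x) field_differentiable at x"
    and "deriv (\<lambda>x. f x * g x) = (\<lambda>x. deriv f x * g x + deriv g x * f x)"
    using DERIV_imp_deriv field_differentiable_def by blast+
  moreover have "(\<lambda>x. deriv f x * g x + deriv g x * f x) \<in> smooth_alg"
    using smooth_alg.mult[of "deriv f" g] smooth_alg.mult[of "deriv g" f] smooth_alg.add
      mult.IH mult.hyps by simp
  ultimately show ?case by simp
qed

lemma smooth_alg_eq: "f \<in> smooth_alg \<longleftrightarrow> smooth f"
  using smooth_coinduct[of f smooth_alg] smooth_alg_deriv by (blast intro: smooth_alg.base)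

lemma smooth_add: "smooth f \<Longrightarrow> smooth g \<Longrightarrow> smooth (\<lambda>x. f x + g x)"
  using smooth_alg.add by (simp add: smooth_alg_eq)

lemma smooth_mult: "smooth f \<Longrightarrow> smooth g \<Longrightarrow> smooth (\<lambda>x. f x * g x)"
  using smooth_alg.mult by (simp add: smooth_alg_eq)

lemma smooth_diff: "smooth f \<Longrightarrow> smooth g \<Longrightarrow> smooth (\<lambda>x. f x - g x)"
  using smooth_add[of f "\<lambda>x. (-1) * g x"] smooth_mult[OF smooth_const[of "-1"], of g] by simp

lemma DERIV_affine:
  assumes "smooth f"
  shows "((\<lambda>x. f (a * x + b)) has_field_derivative deriv f (a * x + b) * a) (at x)"
  by (rule DERIV_chain2[where g="\<lambda>x. a * x + b"])
     (auto intro!: derivative_eq_intros smooth_imp_DERIV assms)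

lemma smooth_affine:
  assumes "smooth f"
  shows "smooth (\<lambda>x. f (a * x + b))"
\<comment> \<open>The factor \<open>c\<close> collects the powers of \<open>a\<close> that the chain
  rule produces.\<close>
proof (rule smooth_coinduct[of _ "{(\<lambda>x. c * g (a * x + b)) | c g. smooth g}"])
  show "(\<lambda>x. f (a * x + b)) \<in> {(\<lambda>x. c * g (a * x + b)) | c g. smooth g}"
    using assms by (auto intro!: exI[of _ 1] exI[of _ f])
next
  fix h assume "h \<in> {(\<lambda>x. c * g (a * x + b)) | c g. smooth g}"
  then obtain c g where g: "smooth g" and h: "h = (\<lambda>x. c * g (a * x + b))" by auto
  have d: "(h has_field_derivative (c * a) * deriv g (a * x + b)) (at x)" for x
    unfolding h by (rule derivative_eq_intros DERIV_affine[OF g] refl | simp)+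
  then show "h field_differentiable at x" for x
    using field_differentiable_def by blast
  have "deriv h = (\<lambda>x. (c * a) * deriv g (a * x + b))"
    using d DERIV_imp_deriv by blast
  then show "deriv h \<in> {(\<lambda>x. c * g (a * x + b)) | c g. smooth g}"
    using smooth_deriv[OF g] by blast
qed

section \<open>Flat exponentials and a smooth step function\<close>

lemma poly_times_exp_tendsto_0:
  fixes p :: "real poly"
  shows "((\<lambda>x. poly p x * exp (- x)) \<longlongrightarrow> 0) at_top"
proof -
  have "((\<lambda>x. \<Sum>i\<le>degree p. coeff p i * (x ^ i / exp x)) \<longlongrightarrow> (\<Sum>i\<le>degree p. coeff p i * 0)) at_top"
    by (intro tendsto_intros tendsto_power_div_exp_0)
  then show ?thesis
    by (simp add: poly_altdef exp_minus divide_inverse sum_distrib_right mult.assoc)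
qed

text \<open>The classical flat function exp (-1/x), with a polynomial in 1/x as a factor:
  differentiation changes only the polynomial, which makes the family invariant under
  \<open>deriv\<close>.\<close>

definition flat_exp :: "real poly \<Rightarrow> real \<Rightarrow> real" where
  "flat_exp p x = (if x > 0 then poly p (1 / x) * exp (- (1 / x)) else 0)"

text \<open>In the variable t = 1/x one has d/dx = - t^2 d/dt, and d/dt (p exp (-t)) = (p' - p) exp
  (-t). At 0 the difference quotients tend to 0 because exponential decay beats every polynomial in
  1/h.\<close>

lemma flat_exp_DERIV:
  "(flat_exp p has_field_derivative flat_exp ((p - pderiv p) * monom 1 2) x) (at x)"
proof (cases x "0::real" rule: linorder_cases)
  case less
  have "eventually (\<lambda>y. y \<in> {..<0}) (nhds x)"
    using less by (intro eventually_nhds_in_open) auto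
  then have "\<forall>\<^sub>F y in nhds x. flat_exp p y = 0"
    by eventually_elim (auto simp: flat_exp_def)
  from DERIV_cong_ev[OF refl this refl, of 0] less show ?thesis
    by (simp add: flat_exp_def[abs_def])
next
  case greater
  have "eventually (\<lambda>y. y \<in> {0<..}) (nhds x)"
    using greater by (intro eventually_nhds_in_open) auto
  then have ev: "\<forall>\<^sub>F y in nhds x. flat_exp p y = poly p (1 / y) * exp (- (1 / y))"
    by eventually_elim (auto simp: flat_exp_def)
  have "((\<lambda>y. poly p (1 / y) * exp (- (1 / y))) has_field_derivative
      flat_exp ((p - pderiv p) * monom 1 2) x) (at x)"
    using greater
    by (auto intro!: derivative_eq_intros DERIV_chain2[where f="poly p", OF poly_DERIV]
        simp: flat_exp_def poly_monom field_simps power2_eq_square)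
  then show ?thesis
    using DERIV_cong_ev[OF refl ev refl] by simp
next
  case equal
  \<comment> \<open>The extra factor \<open>monom 1 1\<close> becomes the 1/h of the difference
    quotient once \<open>h\<close> is replaced by its inverse.\<close>
  have "((\<lambda>h. poly (p * monom 1 1) h * exp (- h)) \<longlongrightarrow> 0) at_top"
    by (rule poly_times_exp_tendsto_0)
  then have "((\<lambda>h. poly (p * monom 1 1) (inverse h) * exp (- (inverse h))) \<longlongrightarrow> 0) (at_right 0)"
    by (rule filterlim_compose[OF _ filterlim_inverse_at_top_right])
  then have r: "((\<lambda>h. flat_exp p h / h) \<longlongrightarrow> 0) (at_right 0)"
    by (rule Lim_transform_eventually)
       (auto simp: eventually_at_filter flat_exp_def poly_monom field_simps)
  have l: "((\<lambda>h. flat_exp p h / h) \<longlongrightarrow> 0) (at_left 0)"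
    by (rule Lim_transform_eventually[OF tendsto_const])
       (auto simp: eventually_at_filter flat_exp_def)
  have "((\<lambda>h. flat_exp p h / h) \<longlongrightarrow> 0) (at 0)"
    using l r by (simp add: filterlim_at_split)
  then show ?thesis
    using equal by (simp add: DERIV_def flat_exp_def)
qed

lemma smooth_flat_exp: "smooth (flat_exp p)"
proof (rule smooth_coinduct[of _ "range flat_exp"])
  fix f assume "f \<in> range flat_exp"
  then obtain q where f: "f = flat_exp q" by auto
  show "f field_differentiable at x" for x
    unfolding f using flat_exp_DERIV field_differentiable_def by blast
  show "deriv f \<in> range flat_exp"
    unfolding f using DERIV_imp_deriv[OF flat_exp_DERIV] by blast
qed auto

text \<open>A normalized primitive of a bump that is positive exactly on (0, 1). The clauses on
  \<open>deriv S\<close> are what makes rescaled copies of \<open>deriv S\<close> usable as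
  averaging kernels.\<close>

lemma smooth_step_exists:
  obtains S where "smooth S" "\<And>x. x \<le> 0 \<Longrightarrow> S x = 0" "\<And>x. x \<ge> 1 \<Longrightarrow> S x = 1" "\<And>x. deriv S x \<ge> 0"
    "\<And>x. x \<le> 0 \<or> x \<ge> 1 \<Longrightarrow> deriv S x = 0"
proof -
  define \<beta> where "\<beta> x = flat_exp 1 x * flat_exp 1 (-1 * x + 1)" for x
  have \<beta>: "smooth \<beta>"
    unfolding \<beta>_def by (rule smooth_mult[OF smooth_flat_exp smooth_affine[OF smooth_flat_exp]])
  have nonneg: "\<beta> x \<ge> 0" and zero: "x \<le> 0 \<or> x \<ge> 1 \<Longrightarrow> \<beta> x = 0"
    and pos: "0 < x \<Longrightarrow> x < 1 \<Longrightarrow> \<beta> x > 0" for x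
    by (auto simp: \<beta>_def flat_exp_def)
  have "isCont \<beta> x" for x
    using smooth_imp_DERIV[OF \<beta>] DERIV_isCont by blast
  \<comment> \<open>The primitive is needed on the whole line, also to the left of 0.\<close>
  then have "\<exists>F. \<forall>x::real. (-\<infinity>::ereal) < x \<longrightarrow> x < \<infinity> \<longrightarrow> (F has_vector_derivative \<beta> x) (at x)"
    by (intro einterval_antiderivative) auto
  then obtain F where F: "\<And>x. (F has_field_derivative \<beta> x) (at x)"
    by (auto simp: has_real_derivative_iff_has_vector_derivative)
  have cont: "continuous_on A F" for A
    using F by (intro continuous_at_imp_continuous_on ballI) (rule DERIV_isCont)
  have F0: "F x = F 0" if "x \<le> 0" for x
  proof (cases "x = 0")
    case False
    then have "F 0 = F x"
      using that F zero by (intro DERIV_isconst_end cont) (metis less_le)+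
    then show ?thesis by simp
  qed simp
  have F1: "F x = F 1" if "x \<ge> 1" for x
  proof (cases "x = 1")
    case False
    then show ?thesis
      using that F zero by (intro DERIV_isconst_end cont) (metis less_le)+
  qed simp
  obtain z where "0 < z" "z < 1" "F 1 - F 0 = (1 - 0) * \<beta> z"
    using MVT2[of 0 1 F \<beta>] F by auto
  then have Fpos: "F 1 - F 0 > 0"
    using pos by simp
  define S where "S x = (F x - F 0) / (F 1 - F 0)" for x
  have dS: "(S has_field_derivative \<beta> x * (1 / (F 1 - F 0))) (at x)" for x
    unfolding S_def using DERIV_cdivide[OF DERIV_diff[OF F DERIV_const]] by simp
  then have dS': "deriv S = (\<lambda>x. \<beta> x * (1 / (F 1 - F 0)))"
    by (intro ext DERIV_imp_deriv)
  have "smooth (deriv S)"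
    unfolding dS' by (rule smooth_mult[OF \<beta> smooth_const])
  have "S field_differentiable at x" for x
    unfolding field_differentiable_def by (rule exI, rule dS)
  from this \<open>smooth (deriv S)\<close> have "smooth S"
    by (rule smooth_if_smooth_deriv)
  moreover have "S x = 0" if "x \<le> 0" for x
    using F0[OF that] by (simp add: S_def)
  moreover have "S x = 1" if "x \<ge> 1" for x
    using F1[OF that] Fpos by (simp add: S_def)
  moreover have "deriv S x \<ge> 0" for x
    using Fpos nonneg[of x] unfolding dS' by simp
  moreover have "deriv S x = 0" if "x \<le> 0 \<or> x \<ge> 1" for x
    using zero[OF that] unfolding dS' by simp
  ultimately show ?thesis
    by (rule that)
qed

section \<open>Weak derivatives in one dimension\<close>

text \<open>An approximate identity: the rescaled \<open>deriv S\<close> is nonnegative, lives on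
  \<open>{z..z + e}\<close> and has mass one, since \<open>S\<close> climbs from 0 to 1. The
  integral is thus an average of the values of \<open>v\<close> just to the right of
  \<open>z\<close>.\<close>

lemma smooth_kernel_integral:
  fixes v S :: "real \<Rightarrow> real"
  assumes S: "smooth S" "\<And>x. x \<le> 0 \<Longrightarrow> S x = 0" "\<And>x. x \<ge> 1 \<Longrightarrow> S x = 1"
    "\<And>x. deriv S x \<ge> 0" "\<And>x. x \<le> 0 \<or> x \<ge> 1 \<Longrightarrow> deriv S x = 0"
    and v: "continuous_on {a..b} v" and z: "a \<le> z" "z + e \<le> b" "e > 0"
    and bd: "\<And>t. z \<le> t \<Longrightarrow> t \<le> z + e \<Longrightarrow> \<bar>v t - v z\<bar> \<le> \<eta>"
  shows "(\<lambda>t. v t * (deriv S ((1 / e) * t + - z / e) * (1 / e))) integrable_on {a..b}"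
    and "\<bar>integral {a..b} (\<lambda>t. v t * (deriv S ((1 / e) * t + - z / e) * (1 / e))) - v z\<bar> \<le> \<eta>"
proof -
  define K where "K t = deriv S ((1 / e) * t + - z / e) * (1 / e)" for t
  have cK: "continuous_on A K" for A
    unfolding K_def
    by (intro continuous_intros continuous_on_compose2[OF smooth_continuous_on[OF smooth_deriv[OF S(1)], of UNIV]]) auto
  have K0: "K t \<ge> 0" for t
    using S(4) z(3) by (simp add: K_def)
  have Kz: "K t = 0" if "t < z \<or> z + e < t" for t
  proof -
    have "(1 / e) * t + - z / e \<le> 0 \<or> (1 / e) * t + - z / e \<ge> 1"
      using that z(3) by (auto simp: field_simps)
    then show ?thesis
      using S(5) by (simp add: K_def)
  qed
  have "(K has_integral S ((1 / e) * b + - z / e) - S ((1 / e) * a + - z / e)) {a..b}"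
    unfolding K_def
  proof (rule fundamental_theorem_of_calculus)
    show "((\<lambda>t. S ((1 / e) * t + - z / e)) has_vector_derivative
        deriv S ((1 / e) * t + - z / e) * (1 / e)) (at t within {a..b})" for t
      using DERIV_subset[OF DERIV_affine[OF S(1)]]
      unfolding has_real_derivative_iff_has_vector_derivative[symmetric] by blast
  qed (use z in simp)
  moreover have "S ((1 / e) * b + - z / e) = 1" "S ((1 / e) * a + - z / e) = 0"
    using z by (auto intro!: S(2,3) simp: field_simps)
  ultimately have K1: "(K has_integral 1) {a..b}" by simp
  show i: "(\<lambda>t. v t * (deriv S ((1 / e) * t + - z / e) * (1 / e))) integrable_on {a..b}"
    by (rule integrable_continuous_real[OF continuous_on_mult[OF v cK[unfolded K_def]]])
  then have "((\<lambda>t. v t * K t) has_integral integral {a..b} (\<lambda>t. v t * K t)) {a..b}"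
    unfolding K_def by (rule integrable_integral)
  from has_integral_diff[OF this has_integral_mult_right[OF K1, of "v z"]]
  have d: "((\<lambda>t. (v t - v z) * K t) has_integral (integral {a..b} (\<lambda>t. v t * K t) - v z)) {a..b}"
    by (simp add: algebra_simps)
  have "norm ((v t - v z) * K t) \<le> \<eta> * K t" for t
    using bd[of t] Kz[of t] K0[of t]
    by (cases "z \<le> t \<and> t \<le> z + e") (auto simp: abs_mult intro: mult_right_mono)
  then have "norm (integral {a..b} (\<lambda>t. (v t - v z) * K t)) \<le> integral {a..b} (\<lambda>t. \<eta> * K t)"
    using d has_integral_mult_right[OF K1, of \<eta>]
    by (intro integral_norm_bound_integral) (auto simp: has_integral_integrable)
  also have "\<dots> = \<eta>"
    using integral_unique[OF has_integral_mult_right[OF K1, of \<eta>]] by simp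
  finally show "\<bar>integral {a..b} (\<lambda>t. v t * (deriv S ((1 / e) * t + - z / e) * (1 / e))) - v z\<bar> \<le> \<eta>"
    unfolding integral_unique[OF d] by (simp only: K_def real_norm_def)
qed

section \<open>Test functions and products with compact support\<close>

lemma set_lebesgue_integral_restrict:
  fixes f :: "'a \<Rightarrow> real"
  assumes "\<And>x. x \<in> A \<Longrightarrow> x \<notin> B \<Longrightarrow> f x = 0" "\<And>x. x \<in> B \<Longrightarrow> x \<notin> A \<Longrightarrow> f x = 0"
  shows "(LINT x:A|M. f x) = (LINT x:B|M. f x)"
  unfolding set_lebesgue_integral_def
  using assms by (intro Bochner_Integration.integral_cong) (auto simp: indicator_def)

lemma absolutely_integrable_mult_continuous:
  fixes f g :: "real \<Rightarrow> real"
  assumes "f absolutely_integrable_on K" "continuous_on K g" "compact K"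
  shows "(\<lambda>x. f x * g x) absolutely_integrable_on K"
proof -
  have "K \<in> sets lebesgue"
    using assms(3) by (simp add: compact_imp_closed)
  then have "(\<lambda>x. g x * f x) absolutely_integrable_on K"
    using assms
    by (intro absolutely_integrable_bounded_measurable_product_real)
       (auto intro: continuous_imp_measurable_on_sets_lebesgue compact_imp_bounded compact_continuous_image)
  then show ?thesis by (simp add: mult.commute)
qed

lemma test_functions_deriv_zero:
  assumes "\<phi> \<in> test_functions U" "x \<notin> closure {x. \<phi> x \<noteq> 0}"
  shows "deriv \<phi> x = 0"
proof -
  have z: "\<phi> y = 0" if "y \<in> - closure {x. \<phi> x \<noteq> 0}" for y
    using that closure_subset[of "{x. \<phi> x \<noteq> 0}"] by blast
  have ev: "eventually (\<lambda>y. y \<in> - closure {x. \<phi> x \<noteq> 0}) (nhds x)"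
    using assms(2) by (intro eventually_nhds_in_open) auto
  have "\<forall>\<^sub>F y in nhds x. \<phi> y = 0"
    by (rule eventually_mono[OF ev z])
  from DERIV_cong_ev[OF refl this refl, of 0] have "(\<phi> has_field_derivative 0) (at x)"
    by simp
  then show ?thesis by (rule DERIV_imp_deriv)
qed

lemma test_functions_support:
  assumes "\<phi> \<in> test_functions U"
  obtains K where "compact K" "K \<subseteq> U" "\<And>x. x \<notin> K \<Longrightarrow> \<phi> x = 0" "\<And>x. x \<notin> K \<Longrightarrow> deriv \<phi> x = 0"
proof
  show "compact (closure {x. \<phi> x \<noteq> 0})" "closure {x. \<phi> x \<noteq> 0} \<subseteq> U"
    using assms by (auto simp: test_functions_def)
  show "\<phi> x = 0" if "x \<notin> closure {x. \<phi> x \<noteq> 0}" for x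
    using that closure_subset[of "{x. \<phi> x \<noteq> 0}"] by blast
qed (rule test_functions_deriv_zero[OF assms])

lemma test_functions_smooth: "\<phi> \<in> test_functions U \<Longrightarrow> smooth \<phi>"
  by (simp add: test_functions_def)

lemma locally_integrable_mult_compact_support:
  assumes "locally_integrable U g" "continuous_on UNIV \<psi>" "compact K" "K \<subseteq> U" "\<And>x. x \<notin> K \<Longrightarrow> \<psi> x = 0"
  shows "set_integrable lebesgue U (\<lambda>x. g x * \<psi> x)"
proof -
  have "(\<lambda>x. g x * \<psi> x) absolutely_integrable_on K"
    using assms by (intro absolutely_integrable_mult_continuous)
      (auto simp: locally_integrable_def intro: continuous_on_subset)
  moreover have "indicat_real U x *\<^sub>R (g x * \<psi> x) = indicat_real K x *\<^sub>R (g x * \<psi> x)" for x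
    using assms(4,5) by (auto simp: indicator_def)
  ultimately show ?thesis
    unfolding set_integrable_def by (simp only:)
qed

lemma weak_deriv_integrable:
  assumes "has_weak_deriv U v g" "\<phi> \<in> test_functions U"
  shows "set_integrable lebesgue U (\<lambda>x. v x * deriv \<phi> x)" "set_integrable lebesgue U (\<lambda>x. g x * \<phi> x)"
proof -
  obtain K where K: "compact K" "K \<subseteq> U" "\<And>x. x \<notin> K \<Longrightarrow> \<phi> x = 0" "\<And>x. x \<notin> K \<Longrightarrow> deriv \<phi> x = 0"
    using test_functions_support[OF assms(2)] by blast
  have s: "smooth \<phi>" "smooth (deriv \<phi>)"
    using test_functions_smooth[OF assms(2)] smooth_deriv by auto
  show "set_integrable lebesgue U (\<lambda>x. v x * deriv \<phi> x)"
    using assms(1) K s by (intro locally_integrable_mult_compact_support[of U v "deriv \<phi>" K])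
      (auto simp: has_weak_deriv_def smooth_continuous_on)
  show "set_integrable lebesgue U (\<lambda>x. g x * \<phi> x)"
    using assms(1) K s by (intro locally_integrable_mult_compact_support[of U g \<phi> K])
      (auto simp: has_weak_deriv_def smooth_continuous_on)
qed

lemma has_weak_deriv_diff:
  assumes "has_weak_deriv U v g" "has_weak_deriv U w h"
  shows "has_weak_deriv U (\<lambda>x. v x - w x) (\<lambda>x. g x - h x)"
  unfolding has_weak_deriv_def
proof (intro conjI ballI)
  show "locally_integrable U (\<lambda>x. v x - w x)" "locally_integrable U (\<lambda>x. g x - h x)"
    using assms by (auto simp: has_weak_deriv_def locally_integrable_def)
  fix \<phi> assume \<phi>: "\<phi> \<in> test_functions U"
  note i = weak_deriv_integrable[OF assms(1) \<phi>] weak_deriv_integrable[OF assms(2) \<phi>]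
  show "(LINT x:U|lebesgue. (v x - w x) * deriv \<phi> x) = - (LINT x:U|lebesgue. (g x - h x) * \<phi> x)"
    using assms \<phi> i by (simp add: left_diff_distrib has_weak_deriv_def)
qed

text \<open>The derivative of a smoothed indicator of the interval is the difference of two kernels
  concentrating at \<open>x\<close> and \<open>y\<close>. Hence one side of the weak identity tends
  to \<open>v x - v y\<close>, by continuity of \<open>v\<close>, and the other to minus the
  integral of \<open>g\<close>, by dominated convergence.\<close>

lemma has_weak_deriv_imp_integral:
  assumes U: "open U" and wd: "has_weak_deriv U v g" and v: "continuous_on U v"
    and xy: "{x..y} \<subseteq> U" "x \<le> y"
  shows "v y - v x = integral {x..y} g"
proof -
  obtain S where S: "smooth S" "\<And>x. x \<le> 0 \<Longrightarrow> S x = 0" "\<And>x. x \<ge> 1 \<Longrightarrow> S x = 1"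
    "\<And>x. deriv S x \<ge> 0" "\<And>x. x \<le> 0 \<or> x \<ge> 1 \<Longrightarrow> deriv S x = 0"
    using smooth_step_exists by metis
  have Smono: "S s \<le> S t" if "s \<le> t" for s t
    using that smooth_imp_DERIV[OF S(1)] S(4) by (intro DERIV_nonneg_imp_nondecreasing[of s t S]) auto
  have S01: "0 \<le> S t" "S t \<le> 1" for t
    using Smono[of "min t 0" t] Smono[of t "max t 1"] S(2)[of "min t 0"] S(3)[of "max t 1"] by auto
  \<comment> \<open>The falling ramp starts at \<open>y\<close> and ends to its right, so the
    support needs a margin inside \<open>U\<close>.\<close>
  obtain r where r: "r > 0" "cball y r \<subseteq> U"
    using U xy open_contains_cball by (metis atLeastAtMost_iff order_refl subsetD)
  have xyr: "{x..y + r} \<subseteq> U"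
  proof
    fix t assume "t \<in> {x..y + r}"
    then show "t \<in> U"
      using xy r by (cases "t \<le> y") (auto simp: cball_def dist_real_def subset_iff)
  qed
  define e where "e n = r / (Suc n)" for n :: nat
  have e: "e n > 0" "e n \<le> r" for n
    using r by (auto simp: e_def field_simps)
  have e0: "e \<longlonglongrightarrow> 0"
    unfolding e_def using LIMSEQ_inverse_real_of_nat[THEN tendsto_mult_right_zero, of r]
    by (simp add: divide_inverse)
  \<comment> \<open>A ramp of width \<open>e n\<close> rising from \<open>x\<close> minus the same
    ramp starting at \<open>y\<close>.\<close>
  define \<phi> where "\<phi> n t = S ((1 / e n) * t + - x / e n) - S ((1 / e n) * t + - y / e n)" for n t
  have d\<phi>: "deriv (\<phi> n) = (\<lambda>t. deriv S ((1 / e n) * t + - x / e n) * (1 / e n)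
      - deriv S ((1 / e n) * t + - y / e n) * (1 / e n))" for n
    unfolding \<phi>_def by (intro ext DERIV_imp_deriv DERIV_diff DERIV_affine S(1))
  have \<phi>0: "\<phi> n t = 0" "deriv (\<phi> n) t = 0" if "t \<notin> {x..y + r}" for n t
  proof -
    from that consider "t < x" | "t > y + r" by fastforce
    then have "((1 / e n) * t + - x / e n \<le> 0 \<and> (1 / e n) * t + - y / e n \<le> 0) \<or>
      ((1 / e n) * t + - x / e n \<ge> 1 \<and> (1 / e n) * t + - y / e n \<ge> 1)"
      using e[of n] xy(2) by cases (auto simp: field_simps)
    then show "\<phi> n t = 0" "deriv (\<phi> n) t = 0"
      using S(2,3,5) unfolding d\<phi> by (auto simp: \<phi>_def)
  qed
  have "closure {t. \<phi> n t \<noteq> 0} \<subseteq> {x..y + r}" for n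
    using \<phi>0(1) by (intro closure_minimal) (blast, simp)
  moreover have "smooth (\<phi> n)" for n
    unfolding \<phi>_def[abs_def] by (rule smooth_diff[OF smooth_affine[OF S(1)] smooth_affine[OF S(1)]])
  ultimately have test: "\<phi> n \<in> test_functions U" for n
    using xyr compact_Int_closed[OF compact_Icc closed_closure, of x "y + r" "{t. \<phi> n t \<noteq> 0}"]
    unfolding test_functions_def by (simp add: Int_absorb1 subset_trans[OF _ xyr])
  have ig: "g absolutely_integrable_on {x..y + r}"
    using wd xyr by (auto simp: has_weak_deriv_def locally_integrable_def)
  have ig\<phi>: "(\<lambda>t. g t * \<phi> n t) absolutely_integrable_on {x..y + r}" for n
    by (intro absolutely_integrable_mult_continuous ig smooth_continuous_on test_functions_smooth[OF test]) auto
  have cv: "continuous_on {x..y + r} v"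
    using v xyr continuous_on_subset by blast
  have iv\<phi>: "(\<lambda>t. v t * deriv (\<phi> n) t) absolutely_integrable_on {x..y + r}" for n
    by (intro absolutely_integrable_continuous_real continuous_on_mult cv
        smooth_continuous_on smooth_deriv test_functions_smooth[OF test])
  have eq: "integral {x..y + r} (\<lambda>t. v t * deriv (\<phi> n) t) = - integral {x..y + r} (\<lambda>t. g t * \<phi> n t)" for n
  proof -
    have "(LINT t:U|lebesgue. v t * deriv (\<phi> n) t) = - (LINT t:U|lebesgue. g t * \<phi> n t)"
      using wd test by (auto simp: has_weak_deriv_def)
    also have "(LINT t:U|lebesgue. v t * deriv (\<phi> n) t) = (LINT t:{x..y + r}|lebesgue. v t * deriv (\<phi> n) t)"
      using \<phi>0 xyr by (intro set_lebesgue_integral_restrict) auto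
    also have "(LINT t:U|lebesgue. g t * \<phi> n t) = (LINT t:{x..y + r}|lebesgue. g t * \<phi> n t)"
      using \<phi>0 xyr by (intro set_lebesgue_integral_restrict) auto
    finally show ?thesis
      using set_lebesgue_integral_eq_integral(2)[OF iv\<phi>[of n]] set_lebesgue_integral_eq_integral(2)[OF ig\<phi>[of n]]
      by simp
  qed
  have near: "(\<lambda>n. integral {x..y + r} (\<lambda>t. v t * (deriv S ((1 / e n) * t + - z / e n) * (1 / e n)))) \<longlonglongrightarrow> v z"
    if z: "z \<in> {x..y}" for z
  proof (rule LIMSEQ_I)
    fix \<eta> :: real assume "\<eta> > 0"
    have "z \<in> {x..y + r}"
      using z r by auto
    then obtain d where d: "d > 0" "\<And>t. t \<in> {x..y + r} \<Longrightarrow> dist t z < d \<Longrightarrow> dist (v t) (v z) < \<eta> / 2"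
      using cv \<open>\<eta> > 0\<close> unfolding continuous_on_iff by (meson half_gt_zero)
    obtain N where N: "\<And>n. n \<ge> N \<Longrightarrow> e n < d"
      using LIMSEQ_D[OF e0 d(1)] by fastforce
    show "\<exists>N. \<forall>n\<ge>N. norm (integral {x..y + r} (\<lambda>t. v t * (deriv S ((1 / e n) * t + - z / e n) * (1 / e n))) - v z) < \<eta>"
    proof (intro exI allI impI)
      fix n assume "n \<ge> N"
      have "\<bar>v t - v z\<bar> \<le> \<eta> / 2" if "z \<le> t" "t \<le> z + e n" for t
        using d(2)[of t] N[OF \<open>n \<ge> N\<close>] that z e[of n] by (auto simp: dist_real_def)
      then have "\<bar>integral {x..y + r} (\<lambda>t. v t * (deriv S ((1 / e n) * t + - z / e n) * (1 / e n))) - v z\<bar> \<le> \<eta> / 2"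
        using z e[of n] by (intro smooth_kernel_integral(2)[OF S cv]) auto
      then show "norm (integral {x..y + r} (\<lambda>t. v t * (deriv S ((1 / e n) * t + - z / e n) * (1 / e n))) - v z) < \<eta>"
        using \<open>\<eta> > 0\<close> by simp
    qed
  qed
  have cK: "(\<lambda>t. v t * (deriv S ((1 / e n) * t + - z / e n) * (1 / e n))) integrable_on {x..y + r}" for n z
    by (intro integrable_continuous_real continuous_intros cv
        continuous_on_compose2[OF smooth_continuous_on[OF smooth_deriv[OF S(1)], of UNIV]]) auto
  have "(\<lambda>n. integral {x..y + r} (\<lambda>t. v t * (deriv S ((1 / e n) * t + - x / e n) * (1 / e n))) -
      integral {x..y + r} (\<lambda>t. v t * (deriv S ((1 / e n) * t + - y / e n) * (1 / e n)))) \<longlonglongrightarrow> v x - v y"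
    by (intro tendsto_diff near) (use xy in auto)
  then have lim1: "(\<lambda>n. integral {x..y + r} (\<lambda>t. v t * deriv (\<phi> n) t)) \<longlonglongrightarrow> v x - v y"
    unfolding d\<phi> right_diff_distrib
    by (simp only: Henstock_Kurzweil_Integration.integral_diff[OF cK cK])
  have "(\<lambda>n. integral {x..y + r} (\<lambda>t. g t * \<phi> n t)) \<longlonglongrightarrow>
      integral {x..y + r} (\<lambda>t. if t \<in> {x<..y} then g t else 0)"
  proof (rule dominated_convergence(2))
    show "(\<lambda>t. g t * \<phi> n t) integrable_on {x..y + r}" for n
      using ig\<phi> set_lebesgue_integral_eq_integral(1) by blast
    show "(\<lambda>t. \<bar>g t\<bar>) integrable_on {x..y + r}"
      using ig by (simp add: absolutely_integrable_on_def)
    show "norm (g t * \<phi> n t) \<le> \<bar>g t\<bar>" for n t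
    proof -
      have "\<bar>\<phi> n t\<bar> \<le> 1"
        using S01[of "(1 / e n) * t + - x / e n"] S01[of "(1 / e n) * t + - y / e n"]
        unfolding \<phi>_def by linarith
      then show ?thesis
        using mult_left_mono[of "\<bar>\<phi> n t\<bar>" 1 "\<bar>g t\<bar>"] by (simp add: abs_mult)
    qed
    fix t assume t: "t \<in> {x..y + r}"
    \<comment> \<open>At \<open>t = z\<close> the ramp has not started, so the limit is 0 there.
      This is why the indicator of the left-open interval \<open>{x<..y}\<close> appears; the
      missing point is null.\<close>
    have lim: "(\<lambda>n. S ((1 / e n) * t + - z / e n)) \<longlonglongrightarrow> (if t \<le> z then 0 else 1)" for z
    proof (rule tendsto_eventually)
      show "\<forall>\<^sub>F n in sequentially. S ((1 / e n) * t + - z / e n) = (if t \<le> z then 0 else 1)"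
      proof (cases "t \<le> z")
        case True
        have "(1 / e n) * t + - z / e n \<le> 0" for n
          using True e[of n] by (auto simp: field_simps)
        then show ?thesis
          using True S(2) by simp
      next
        case False
        then have "\<forall>\<^sub>F n in sequentially. e n < t - z"
          using e0 by (intro order_tendstoD(2)) auto
        then show ?thesis
        proof eventually_elim
          case (elim n)
          then have "(1 / e n) * t + - z / e n \<ge> 1"
            using e[of n] by (auto simp: field_simps)
          then show ?case using False S(3) by simp
        qed
      qed
    qed
    have "(\<lambda>n. g t * \<phi> n t) \<longlonglongrightarrow> g t * ((if t \<le> x then 0 else 1) - (if t \<le> y then 0 else 1))"
      unfolding \<phi>_def by (intro tendsto_intros lim)
    then show "(\<lambda>n. g t * \<phi> n t) \<longlonglongrightarrow> (if t \<in> {x<..y} then g t else 0)"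
      using xy by (auto split: if_splits)
  qed
  then have "(\<lambda>n. - integral {x..y + r} (\<lambda>t. v t * deriv (\<phi> n) t)) \<longlonglongrightarrow>
      integral {x..y + r} (\<lambda>t. if t \<in> {x<..y} then g t else 0)"
    unfolding eq by simp
  from LIMSEQ_unique[OF tendsto_minus[OF lim1] this]
  have "v y - v x = integral {x..y + r} (\<lambda>t. if t \<in> {x<..y} then g t else 0)"
    by simp
  also have "\<dots> = integral ({x<..y} \<inter> {x..y + r}) g"
    by (rule integral_restrict_Int)
  also have "{x<..y} \<inter> {x..y + r} = {x<..y}"
    using r by auto
  also have "integral {x<..y} g = integral {x..y} g"
    by (rule integral_spike_set) (auto intro: negligible_subset[of "{x}"])
  finally show ?thesis .
qed

text \<open>Lebesgue differentiation: off a null set, the value at \<open>x\<close> is the limit of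
  averages over intervals starting at \<open>x\<close>, and all of these are 0.\<close>

lemma integral_zero_imp_negligible:
  fixes h :: "real \<Rightarrow> real"
  assumes h: "h integrable_on {a..b}" and zero: "\<And>x y. a \<le> x \<Longrightarrow> x \<le> y \<Longrightarrow> y \<le> b \<Longrightarrow> integral {x..y} h = 0"
  shows "negligible {t \<in> {a..b}. h t \<noteq> 0}"
proof -
  \<comment> \<open>The differentiation theorem asks for integrability on every compact interval,
    which extension by zero provides.\<close>
  define H where "H t = (if t \<in> {a..b} then h t else 0)" for t
  have int: "integral {x..y} H = 0" "H integrable_on {x..y}" for x y
  proof -
    have I: "{a..b} \<inter> {x..y} = {max a x..min b y}" by auto
    show "integral {x..y} H = 0"
      using zero[of "max a x" "min b y"] unfolding H_def integral_restrict_Int I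
      by (cases "max a x \<le> min b y") (simp, simp only: atLeastatMost_empty not_le integral_empty)
    show "H integrable_on {x..y}"
      unfolding H_def integrable_restrict_Int I
      by (rule integrable_on_subinterval[OF h]) auto
  qed
  then obtain N where N: "negligible N" "\<And>x e. \<lbrakk>x \<notin> N; 0 < e\<rbrakk> \<Longrightarrow>
      \<exists>d>0. \<forall>h. 0 < h \<and> h < d \<longrightarrow> norm (integral {x..x + h *\<^sub>R One} H /\<^sub>R h ^ DIM(real) - H x) < e"
    using integrable_ccontinuous_explicit[of H] by (metis cbox_interval)
  have "H x = 0" if x: "x \<notin> N" for x
  proof (rule ccontr)
    assume "H x \<noteq> 0"
    then obtain d where d: "d > 0" "\<And>h. 0 < h \<Longrightarrow> h < d \<Longrightarrow>
        norm (integral {x..x + h *\<^sub>R One} H /\<^sub>R h ^ DIM(real) - H x) < \<bar>H x\<bar>"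
      using N(2)[OF x, of "\<bar>H x\<bar>"] zero_less_abs_iff by metis
    from d(2)[of "d / 2"] d(1) show False
      by (simp add: int)
  qed
  then have "{t \<in> {a..b}. h t \<noteq> 0} \<subseteq> N"
    by (force simp: H_def)
  then show ?thesis
    using N(1) negligible_subset by blast
qed

text \<open>This makes the choice in \<open>weak_deriv\<close> harmless. The difference of two weak
  derivatives is one of the continuous function 0, so its integrals over compact subintervals of
  \<open>U\<close> vanish; countably many compact intervals cover \<open>U\<close>.\<close>

lemma has_weak_deriv_unique:
  assumes U: "open U" and "has_weak_deriv U v g" "has_weak_deriv U v h"
  shows "negligible {t \<in> U. g t \<noteq> h t}"
proof -
  have wd: "has_weak_deriv U (\<lambda>x. 0) (\<lambda>x. g x - h x)"
    using has_weak_deriv_diff[OF assms(2,3)] by simp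
  obtain \<D> where D: "countable \<D>" "\<D> \<subseteq> Pow U" "\<And>X. X \<in> \<D> \<Longrightarrow> \<exists>a b. X = cbox a b" "\<Union>\<D> = U"
    using open_countable_Union_open_cbox[OF U] by metis
  have "negligible {t \<in> X. g t \<noteq> h t}" if X: "X \<in> \<D>" for X
  proof -
    obtain a b where ab: "X = {a..b}" using D(3)[OF X] by (auto simp: cbox_interval)
    then have sub: "{a..b} \<subseteq> U" using D(2) X by auto
    then have "(\<lambda>x. g x - h x) integrable_on {a..b}"
      using wd set_lebesgue_integral_eq_integral(1)
      unfolding has_weak_deriv_def locally_integrable_def by (metis compact_Icc)
    moreover have "integral {x..y} (\<lambda>x. g x - h x) = 0" if "a \<le> x" "x \<le> y" "y \<le> b" for x y
      using has_weak_deriv_imp_integral[OF U wd _ _ that(2)] sub that by (simp add: subset_iff)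
    ultimately show ?thesis
      using integral_zero_imp_negligible[of "\<lambda>x. g x - h x" a b] by (simp add: ab)
  qed
  then have "negligible (\<Union>X\<in>\<D>. {t \<in> X. g t \<noteq> h t})"
    using D(1) by (intro negligible_countable_Union) auto
  moreover have "(\<Union>X\<in>\<D>. {t \<in> X. g t \<noteq> h t}) = {t \<in> U. g t \<noteq> h t}"
    using D(4) by auto
  ultimately show ?thesis by simp
qed

section \<open>The flux and its inverse\<close>

lemma E_eq:
  assumes "x > 0"
  shows "E k x = x\<^sup>2 * (1 + 2 / real k * ln x)"
  using assms by (simp add: E_def ln_mult ln_powr)

text \<open>The point \<open>exp (- real k / 2)\<close> is the zero of the logarithmic factor of
  \<open>E k\<close>. To its right both factors are nonnegative and increasing, whence the strict
  monotonicity that follows.\<close>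

lemma E_factor_nonneg:
  assumes "k \<ge> 1" "exp (- real k / 2) \<le> x"
  shows "0 \<le> 1 + 2 / real k * ln x"
proof -
  have "x > 0"
    using assms(2) exp_gt_zero less_le_trans by blast
  then have "- real k / 2 \<le> ln x"
    using assms(2) by (simp add: ln_ge_iff)
  then show ?thesis
    using assms(1) by (simp add: field_simps)
qed

lemma E_strict_mono_on:
  assumes "k \<ge> 1"
  shows "strict_mono_on {exp (- real k / 2)..1} (E k)"
proof (rule strict_mono_onI)
  fix x y assume xy: "x \<in> {exp (- real k / 2)..1}" "y \<in> {exp (- real k / 2)..1}" "x < y"
  have x0: "x > 0"
    using xy(1) less_le_trans[OF exp_gt_zero] by auto
  have "x\<^sup>2 * (1 + 2 / real k * ln x) < y\<^sup>2 * (1 + 2 / real k * ln y)"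
  proof (rule mult_strict_mono)
    show "x\<^sup>2 < y\<^sup>2"
      using x0 xy(3) by (intro power_strict_mono) auto
    have "2 / real k * ln x < 2 / real k * ln y"
      using x0 xy(3) assms by (intro mult_strict_left_mono) auto
    then show "1 + 2 / real k * ln x < 1 + 2 / real k * ln y"
      by simp
    show "0 \<le> 1 + 2 / real k * ln x"
      using E_factor_nonneg[OF assms] xy(1) by auto
    show "0 < y\<^sup>2"
      using x0 xy(3) by simp
  qed
  then show "E k x < E k y"
    using x0 xy(3) by (simp add: E_eq)
qed

lemma E_continuous_on: "continuous_on {exp (- real k / 2)..1} (E k)"
proof -
  have "continuous_on {exp (- real k / 2)..1} (\<lambda>x. x\<^sup>2 * (1 + 2 / real k * ln x))"
    by (intro continuous_intros) (use exp_gt_zero[of "- real k / 2"] in auto)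
  then show ?thesis
    using less_le_trans[OF exp_gt_zero[of "- real k / 2"]]
    by (subst continuous_on_cong[OF refl E_eq]) auto
qed

lemma E_image:
  assumes "k \<ge> 1"
  shows "E k ` {exp (- real k / 2)..1} = {0..1}"
proof
  have e: "E k (exp (- real k / 2)) = 0" "E k 1 = 1"
    using assms by (simp_all add: E_eq)
  have le: "exp (- real k / 2) \<le> 1"
    by simp
  have mono: "E k x \<le> E k y" if "exp (- real k / 2) \<le> x" "x \<le> y" "y \<le> 1" for x y
    using strict_mono_on_imp_mono_on[OF E_strict_mono_on[OF assms]] that
    by (auto intro: mono_onD)
  show "E k ` {exp (- real k / 2)..1} \<subseteq> {0..1}"
    using mono[OF order_refl, unfolded e] mono[OF _ _ order_refl, unfolded e] by auto
  show "{0..1} \<subseteq> E k ` {exp (- real k / 2)..1}"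
    using IVT'[of "E k" "exp (- real k / 2)" _ 1] e le E_continuous_on by fastforce
qed

lemma E_inv_props:
  assumes "k \<ge> 1" "y \<in> {0..1}"
  shows "E_inv k y \<in> {exp (- real k / 2)..1}" "E k (E_inv k y) = y"
proof -
  have inj: "inj_on (E k) {exp (- real k / 2)..1}"
    using E_strict_mono_on[OF assms(1)] strict_mono_on_imp_inj_on by blast
  show "E_inv k y \<in> {exp (- real k / 2)..1}"
    unfolding E_inv_def
    by (rule the_inv_into_into[OF inj _ subset_refl]) (simp only: E_image[OF assms(1)] assms(2))
  show "E k (E_inv k y) = y"
    unfolding E_inv_def
    by (rule f_the_inv_into_f[OF inj]) (simp only: E_image[OF assms(1)] assms(2))
qed

lemma E_inv_continuous_on:
  assumes "k \<ge> 1"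
  shows "continuous_on {0..1} (E_inv k)"
proof -
  have "inj_on (E k) {exp (- real k / 2)..1}"
    using E_strict_mono_on[OF assms] strict_mono_on_imp_inj_on by blast
  then have "\<forall>x\<in>{exp (- real k / 2)..1}. E_inv k (E k x) = x"
    by (simp add: E_inv_def the_inv_into_f_f)
  from continuous_on_inv[OF E_continuous_on compact_Icc this] show ?thesis
    by (simp only: E_image[OF assms])
qed

text \<open>The inverse of the flux \<open>s \<mapsto> exp (k * (s\<^sup>2 - 1) / 2) * s\<close> on \<open>{-1..1}\<close>:
  if \<open>x = exp (k * (s\<^sup>2 - 1) / 2)\<close> and \<open>y = x * s\<close>, then \<open>y\<^sup>2 = E k x\<close>.\<close>

definition slope :: "nat \<Rightarrow> real \<Rightarrow> real" where
  "slope k y = y / E_inv k (y\<^sup>2)"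

lemma slope_minus: "slope k (- y) = - slope k y"
  by (simp add: slope_def)

lemma slope_0: "slope k 0 = 0"
  by (simp add: slope_def)

lemma square_in_unit: "\<bar>y\<bar> \<le> 1 \<Longrightarrow> (y::real)\<^sup>2 \<in> {0..1}"
  by (simp add: abs_square_le_1)

text \<open>Dividing \<open>E k x = y\<^sup>2\<close> by \<open>x\<^sup>2\<close> gives slope^2 = 1
  + (2/k) ln x. Hence the exponent k (slope^2 - 1) / 2 is ln x, the weight is \<open>x\<close>, and
  multiplying it by y/x returns \<open>y\<close>. The bound on the slope is
  \<open>x \<le> 1\<close>.\<close>

lemma slope_props:
  assumes k: "k \<ge> 1" and y: "\<bar>y\<bar> \<le> 1"
  shows "\<bar>slope k y\<bar> \<le> 1"
    and "exp (real k * ((slope k y)\<^sup>2 - 1) / 2) * slope k y = y"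
    and "y > 0 \<Longrightarrow> slope k y > 0"
proof -
  define x where "x = E_inv k (y\<^sup>2)"
  have x: "exp (- real k / 2) \<le> x" "x \<le> 1" "E k x = y\<^sup>2"
    using E_inv_props[OF k square_in_unit[OF y]] by (auto simp: x_def)
  have x0: "x > 0"
    using x(1) less_le_trans[OF exp_gt_zero] by blast
  have s: "slope k y = y / x"
    by (simp add: slope_def x_def)
  have s2: "(slope k y)\<^sup>2 = 1 + 2 / real k * ln x"
    using x(3) x0 by (simp add: s E_eq power_divide field_simps)
  have "ln x \<le> 0"
    using x0 x(2) by simp
  then have "(slope k y)\<^sup>2 \<le> 1"
    unfolding s2 using k by (simp add: field_simps)
  then show "\<bar>slope k y\<bar> \<le> 1"
    by (simp add: abs_square_le_1)
  have "real k * ((slope k y)\<^sup>2 - 1) / 2 = ln x"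
    using k by (simp add: s2)
  then show "exp (real k * ((slope k y)\<^sup>2 - 1) / 2) * slope k y = y"
    using x0 by (simp add: s)
  show "y > 0 \<Longrightarrow> slope k y > 0"
    using x0 by (simp add: s)
qed

text \<open>The flux 0 causes no singularity: on the unit interval \<open>E_inv k\<close> is at
  least \<open>exp (- real k / 2)\<close>, so the denominator stays away from 0.\<close>

lemma slope_continuous_on:
  assumes k: "k \<ge> 1"
  shows "continuous_on {-1..1} (slope k)"
proof -
  have "continuous_on {-1..1} (\<lambda>y. E_inv k (y\<^sup>2))"
    by (rule continuous_on_compose2[OF E_inv_continuous_on[OF k]])
       (auto intro!: continuous_intros simp: abs_square_le_1 abs_le_iff)
  moreover have "E_inv k (y\<^sup>2) \<noteq> 0" if "y \<in> {-1..1}" for y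
    using E_inv_props(1)[OF k square_in_unit[of y]] that exp_gt_zero[of "- real k / 2"] by (auto simp: abs_le_iff)
  ultimately show ?thesis
    unfolding slope_def by (intro continuous_intros) auto
qed

text \<open>Intermediate value theorem in \<open>C\<close>. Since the primitive G of
  \<open>g\<close> lies in [0, 1], the flux C - G stays in [-1, 1] for C in [0, 1]. In the open
  interval it is negative for C = 0 and positive for C = 1, the latter because G t < G q \<le> 1.
  The strict signs at both extremes also put \<open>C\<close> strictly between 0 and 1.\<close>

lemma exists_balanced_flux:
  fixes g :: "real \<Rightarrow> real"
  assumes k: "k \<ge> 1" and pq: "p < q" and g: "continuous_on {p..q} g"
    and pos: "\<And>x. x \<in> {p<..<q} \<Longrightarrow> g x > 0" and le1: "integral {p..q} g \<le> 1"
  shows "\<exists>C. 0 < C \<and> C < 1 \<and> integral {p..q} (\<lambda>t. slope k (C - integral {p..t} g)) = 0"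
proof -
  define G where "G t = integral {p..t} g" for t
  have gi: "g integrable_on {p..q}"
    using g by (rule integrable_continuous_real)
  have cG: "continuous_on {p..q} G"
    unfolding G_def using gi by (rule indefinite_integral_continuous_1)
  have less: "integral {s..t} g > 0" if "p \<le> s" "s < t" "t \<le> q" for s t
    using integral_less_real[of s t "\<lambda>_. 0" g] that pos continuous_on_subset[OF g, of "{s..t}"] by auto
  have Gpos: "G t > 0" if "t \<in> {p<..q}" for t
    using less[of p t] that by (simp add: G_def)
  have Gless: "G t < G q" if "t \<in> {p..<q}" for t
    using less[of t q] that Henstock_Kurzweil_Integration.integral_combine[of p t q g] gi by (simp add: G_def)
  have G01: "0 \<le> G t" "G t \<le> 1" if "t \<in> {p..q}" for t
  proof -
    show "0 \<le> G t"
      using Gpos[of t] that by (cases "t = p") (auto simp: G_def)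
    show "G t \<le> 1"
      using Gless[of t] that le1 by (cases "t = q") (auto simp: G_def)
  qed
  define H where "H C = integral {p..q} (\<lambda>t. slope k (C - G t))" for C
  have csl: "continuous_on {p..q} (\<lambda>t. slope k (C - G t))" if "C \<in> {0..1}" for C
    by (rule continuous_on_compose2[OF slope_continuous_on[OF k]])
       (use that G01 in \<open>auto intro!: continuous_intros cG, (smt (verit) atLeastAtMost_iff)+\<close>)
  \<comment> \<open>Joint continuity in \<open>C\<close> and \<open>t\<close> is what makes the
    integral continuous in the parameter \<open>C\<close>.\<close>
  have "continuous_on ({0..1} \<times> {p..q}) (\<lambda>(C, t). slope k (C - G t))"
    unfolding split_def
    by (rule continuous_on_compose2[OF slope_continuous_on[OF k]])
       (use G01 in \<open>auto intro!: continuous_intros continuous_on_compose2[OF cG], (smt (verit) atLeastAtMost_iff)+\<close>)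
  then have "continuous_on {0..1} H"
    unfolding H_def using integral_continuous_on_param[of "{0..1}" p q "\<lambda>C t. slope k (C - G t)"] by simp
  moreover have "H 0 < 0"
  proof -
    have "H 0 < integral {p..q} (\<lambda>_. 0)"
      unfolding H_def
    proof (rule integral_less_real)
      show "slope k (0 - G t) < 0" if "t \<in> {p<..<q}" for t
        using slope_props(3)[OF k, of "G t"] Gpos[of t] G01[of t] that slope_minus[of k "G t"] by auto
    qed (use pq csl[of 0] in auto)
    then show ?thesis by simp
  qed
  moreover have "H 1 > 0"
  proof -
    have "integral {p..q} (\<lambda>_. 0) < H 1"
      unfolding H_def
    proof (rule integral_less_real)
      show "slope k (1 - G t) > 0" if "t \<in> {p<..<q}" for t
        using slope_props(3)[OF k, of "1 - G t"] Gless[of t] G01[of t] G01[of q] that pq by auto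
    qed (use pq csl[of 1] in auto)
    then show ?thesis by simp
  qed
  ultimately obtain C where "0 \<le> C" "C \<le> 1" "H C = 0"
    using IVT'[of H 0 0 1] by auto
  with \<open>H 0 < 0\<close> \<open>H 1 > 0\<close> have "0 < C \<and> C < 1 \<and> H C = 0"
    by (metis less_irrefl order_le_imp_less_or_eq)
  then show ?thesis
    unfolding H_def G_def by blast
qed

text \<open>It is used for a test function against the slope of the solution, for the flux against a
  test function, and for the flux against the difference of a competitor and the solution. In the
  last use \<open>g\<close> is merely integrable.\<close>

lemma integration_by_parts_indefinite_integral:
  fixes g z \<psi> \<psi>' :: "real \<Rightarrow> real"
  assumes pq: "p \<le> q" and g: "g absolutely_integrable_on {p..q}"
    and z: "\<And>x. x \<in> {p..q} \<Longrightarrow> z x = z p + integral {p..x} g"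
    and \<psi>: "\<And>x. x \<in> {p..q} \<Longrightarrow> (\<psi> has_real_derivative \<psi>' x) (at x within {p..q})"
    and \<psi>': "continuous_on {p..q} \<psi>'"
  shows "integral {p..q} (\<lambda>x. \<psi> x * g x) + integral {p..q} (\<lambda>x. \<psi>' x * z x) = \<psi> q * z q - \<psi> p * z p"
proof -
  have gi: "g integrable_on {p..q}" and ga: "(\<lambda>x. \<bar>g x\<bar>) integrable_on {p..q}"
    using g by (auto simp: absolutely_integrable_on_def)
  have c\<psi>: "continuous_on {p..q} \<psi>"
    using \<psi> by (rule DERIV_continuous_on)
  have cz: "continuous_on {p..q} z"
  proof -
    have "continuous_on {p..q} (\<lambda>x. z p + integral {p..x} g)"
      by (intro continuous_intros indefinite_integral_continuous_1 gi)
    then show ?thesis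
      by (rule continuous_on_eq) (rule z[symmetric])
  qed
  have i1: "(\<lambda>x. \<psi> x * g x) integrable_on {p..q}"
    using set_lebesgue_integral_eq_integral(1)[OF absolutely_integrable_mult_continuous[OF g c\<psi> compact_Icc]]
    by (simp only: mult.commute)
  have i2: "(\<lambda>x. \<psi>' x * z x) integrable_on {p..q}"
    by (intro integrable_continuous_real continuous_intros cz \<psi>')
  \<comment> \<open>Since \<open>g\<close> is only integrable, \<open>z\<close> need not be differentiable. Instead, the increments of the
    defect \<open>\<Phi>\<close> are bounded by a product of two increments, so that \<open>\<Phi>\<close> has derivative 0.\<close>
  define \<Phi> where "\<Phi> x = integral {p..x} (\<lambda>x. \<psi> x * g x) + integral {p..x} (\<lambda>x. \<psi>' x * z x) - \<psi> x * z x" for x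
  define M where "M x = integral {p..x} (\<lambda>x. \<bar>g x\<bar>)" for x
  have cM: "continuous_on {p..q} M"
    unfolding M_def using ga by (rule indefinite_integral_continuous_1)
  obtain L where L: "\<And>x. x \<in> {p..q} \<Longrightarrow> \<bar>\<psi>' x\<bar> \<le> L" "L \<ge> 0"
  proof -
    have "bounded (\<psi>' ` {p..q})"
      using \<psi>' by (intro compact_imp_bounded compact_continuous_image) auto
    then obtain B where B: "\<And>x. x \<in> {p..q} \<Longrightarrow> norm (\<psi>' x) \<le> B"
      unfolding bounded_iff by blast
    show ?thesis
    proof (rule that[of "max B 0"])
      show "\<bar>\<psi>' x\<bar> \<le> max B 0" if "x \<in> {p..q}" for x
        using B[OF that] by simp
    qed simp
  qed
  have bound: "\<bar>\<Phi> y - \<Phi> x\<bar> \<le> 2 * L * (y - x) * (M y - M x)" if xy: "p \<le> x" "x \<le> y" "y \<le> q" for x y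
  proof -
    have sub: "{x..y} \<subseteq> {p..q}" using xy by auto
    note ii = integrable_on_subinterval[OF _ sub]
    have split: "integral {p..y} f - integral {p..x} f = integral {x..y} f" if "f integrable_on {p..q}" for f :: "real \<Rightarrow> real"
      using Henstock_Kurzweil_Integration.integral_combine[of p x y f] xy integrable_on_subinterval[OF that, of p y] by simp
    have zd: "z t - z s = integral {s..t} g" if "p \<le> s" "s \<le> t" "t \<le> q" for s t
      using z[of s] z[of t] Henstock_Kurzweil_Integration.integral_combine[of p s t g]
        integrable_on_subinterval[OF gi, of p t] that by simp
    have Md: "M t - M s = integral {s..t} (\<lambda>x. \<bar>g x\<bar>)" if "p \<le> s" "s \<le> t" "t \<le> q" for s t
      using Henstock_Kurzweil_Integration.integral_combine[of p s t "\<lambda>x. \<bar>g x\<bar>"]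
        integrable_on_subinterval[OF ga, of p t] that by (simp add: M_def)
    have Mmono: "M s \<le> M t" if "p \<le> s" "s \<le> t" "t \<le> q" for s t
      using Md[OF that] integral_nonneg[of "\<lambda>x. \<bar>g x\<bar>" "{s..t}"]
        integrable_on_subinterval[OF ga, of s t] that by simp
    have zM: "\<bar>z y - z t\<bar> \<le> M y - M x" if "t \<in> {x..y}" for t
    proof -
      have "\<bar>integral {t..y} g\<bar> \<le> integral {t..y} (\<lambda>x. \<bar>g x\<bar>)"
        using integral_norm_bound_integral[of g "{t..y}" "\<lambda>x. \<bar>g x\<bar>"] that xy
          integrable_on_subinterval[OF ga, of t y] integrable_on_subinterval[OF gi, of t y] by auto
      then show ?thesis
        using zd[of t y] Md[of t y] Mmono[of x t] that xy by auto
    qed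
    have \<psi>d: "\<bar>\<psi> t - \<psi> x\<bar> \<le> L * (y - x)" if "t \<in> {x..y}" for t
    proof -
      have "norm (\<psi> t - \<psi> x) \<le> L * norm (t - x)"
        using \<psi> L(1) sub that xy
        by (intro field_differentiable_bound[of "{p..q}"]) auto
      also have "\<dots> \<le> L * (y - x)"
        using that L(2) by (intro mult_left_mono) auto
      finally show ?thesis by simp
    qed
    have \<psi>i: "(\<psi>' has_integral \<psi> y - \<psi> x) {x..y}"
      using sub xy \<psi>
      by (intro fundamental_theorem_of_calculus)
         (auto simp: has_real_derivative_iff_has_vector_derivative[symmetric] intro: DERIV_subset[OF _ sub])
    have i3: "(\<lambda>t. \<psi> x * g t) integrable_on {x..y}"
      using integrable_on_cmult_left[OF ii[OF gi], of "\<psi> x"] by simp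
    \<comment> \<open>The increment of the product is split so that \<psi> is frozen at
      \<open>x\<close> and \<open>z\<close> at \<open>y\<close>. Each integral then keeps only a
      difference, of size at most \<open>L * (y - x)\<close> for \<psi> and \<open>M y - M x\<close>
      for \<open>z\<close>.\<close>
    have "\<Phi> y - \<Phi> x = integral {x..y} (\<lambda>t. \<psi> t * g t) + integral {x..y} (\<lambda>t. \<psi>' t * z t)
        - (\<psi> x * (z y - z x) + (\<psi> y - \<psi> x) * z y)"
      using split[OF i1] split[OF i2] by (simp add: \<Phi>_def algebra_simps)
    also have "\<dots> = (integral {x..y} (\<lambda>t. \<psi> t * g t) - integral {x..y} (\<lambda>t. \<psi> x * g t))
        + (integral {x..y} (\<lambda>t. \<psi>' t * z t) - integral {x..y} (\<lambda>t. \<psi>' t * z y))"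
      using zd[OF xy] integral_unique[OF has_integral_mult_left[OF \<psi>i, of "z y"]]
      by (simp only: Henstock_Kurzweil_Integration.integral_mult_right algebra_simps)
    also have "\<dots> = integral {x..y} (\<lambda>t. (\<psi> t - \<psi> x) * g t) + integral {x..y} (\<lambda>t. \<psi>' t * (z t - z y))"
      unfolding left_diff_distrib right_diff_distrib
        Henstock_Kurzweil_Integration.integral_diff[OF ii[OF i1] i3]
        Henstock_Kurzweil_Integration.integral_diff[OF ii[OF i2] has_integral_integrable[OF has_integral_mult_left[OF \<psi>i]]]
      by (rule refl)
    finally have eq: "\<Phi> y - \<Phi> x = \<dots>" .
    have "norm (integral {x..y} (\<lambda>t. (\<psi> t - \<psi> x) * g t)) \<le> integral {x..y} (\<lambda>t. (L * (y - x)) * \<bar>g t\<bar>)"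
    proof (rule integral_norm_bound_integral)
      show "(\<lambda>t. (\<psi> t - \<psi> x) * g t) integrable_on {x..y}"
        using integrable_diff[OF ii[OF i1] integrable_on_cmult_left[OF ii[OF gi], of "\<psi> x"]]
        by (simp add: left_diff_distrib)
      show "(\<lambda>t. (L * (y - x)) * \<bar>g t\<bar>) integrable_on {x..y}"
        using integrable_on_cmult_left[OF ii[OF ga], of "L * (y - x)"] by simp
      show "norm ((\<psi> t - \<psi> x) * g t) \<le> (L * (y - x)) * \<bar>g t\<bar>" if "t \<in> {x..y}" for t
        using mult_right_mono[OF \<psi>d[OF that], of "\<bar>g t\<bar>"] by (simp add: abs_mult)
    qed
    then have b1: "\<bar>integral {x..y} (\<lambda>t. (\<psi> t - \<psi> x) * g t)\<bar> \<le> L * (y - x) * (M y - M x)"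
      using Md[OF xy] by simp
    have "norm (integral {x..y} (\<lambda>t. \<psi>' t * (z t - z y))) \<le> integral {x..y} (\<lambda>t. L * (M y - M x))"
    proof (rule integral_norm_bound_integral)
      show "(\<lambda>t. \<psi>' t * (z t - z y)) integrable_on {x..y}"
        by (intro integrable_continuous_real continuous_intros continuous_on_subset[OF cz sub]
            continuous_on_subset[OF \<psi>' sub])
      show "norm (\<psi>' t * (z t - z y)) \<le> L * (M y - M x)" if "t \<in> {x..y}" for t
        using mult_mono[OF L(1)[of t] zM[OF that] L(2)] that sub by (auto simp: abs_mult abs_minus_commute)
    qed auto
    then have b2: "\<bar>integral {x..y} (\<lambda>t. \<psi>' t * (z t - z y))\<bar> \<le> L * (y - x) * (M y - M x)"
      using xy by (simp add: mult_ac)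
    show ?thesis
      unfolding eq using abs_triangle_ineq[of "integral {x..y} (\<lambda>t. (\<psi> t - \<psi> x) * g t)"
          "integral {x..y} (\<lambda>t. \<psi>' t * (z t - z y))"] b1 b2 by linarith
  qed
  \<comment> \<open>Dividing the bound by the distance of \<open>y\<close> and \<open>x\<close>
    leaves an increment of \<open>M\<close>, which tends to 0 by continuity of \<open>M\<close>
    alone.\<close>
  have "(\<Phi> has_real_derivative 0) (at x within {p..q})" if x: "x \<in> {p..q}" for x
    unfolding has_field_derivative_iff
  proof (rule Lim_null_comparison)
    have "((\<lambda>y. M y - M x) \<longlongrightarrow> M x - M x) (at x within {p..q})"
      using cM x by (intro tendsto_intros) (auto simp: continuous_on_def)
    then show "((\<lambda>y. 2 * L * \<bar>M y - M x\<bar>) \<longlongrightarrow> 0) (at x within {p..q})"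
      by (auto intro!: tendsto_mult_right_zero tendsto_rabs_zero)
    show "\<forall>\<^sub>F y in at x within {p..q}. norm ((\<Phi> y - \<Phi> x) / (y - x)) \<le> 2 * L * \<bar>M y - M x\<bar>"
      unfolding eventually_at_filter
    proof (intro always_eventually allI impI)
      fix y assume y: "y \<noteq> x" "y \<in> {p..q}"
      have "\<bar>\<Phi> y - \<Phi> x\<bar> \<le> (2 * L * \<bar>M y - M x\<bar>) * \<bar>y - x\<bar>"
      proof (cases "x \<le> y")
        case True
        then have "\<bar>\<Phi> y - \<Phi> x\<bar> \<le> (2 * L * (y - x)) * (M y - M x)"
          using bound[of x y] x y by simp
        also have "\<dots> \<le> (2 * L * (y - x)) * \<bar>M y - M x\<bar>"
          using L(2) True by (intro mult_left_mono) auto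
        finally show ?thesis using True by (simp only: abs_of_nonneg diff_ge_0_iff_ge mult_ac)
      next
        case False
        then have "\<bar>\<Phi> x - \<Phi> y\<bar> \<le> (2 * L * (x - y)) * (M x - M y)"
          using bound[of y x] x y by simp
        also have "\<dots> \<le> (2 * L * (x - y)) * \<bar>M y - M x\<bar>"
          using L(2) False by (intro mult_left_mono) auto
        also have "\<dots> = (2 * L * \<bar>M y - M x\<bar>) * \<bar>y - x\<bar>"
          using False by (simp add: abs_if)
        finally show ?thesis by (simp only: abs_minus_commute)
      qed
      then show "norm ((\<Phi> y - \<Phi> x) / (y - x)) \<le> 2 * L * \<bar>M y - M x\<bar>"
        using y by (simp add: abs_divide divide_le_eq)
    qed
  qed
  then have "\<Phi> q = \<Phi> p"
    using has_field_derivative_zero_constant[of "{p..q}" \<Phi>] pq by fastforce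
  then show ?thesis
    by (simp add: \<Phi>_def)
qed

section \<open>Minimality of piecewise flux solutions\<close>

lemma set_integral_spike:
  fixes f h :: "real \<Rightarrow> real"
  assumes "set_integrable lebesgue S f" "negligible N" "\<And>x. x \<in> S - N \<Longrightarrow> h x = f x"
  shows "set_integrable lebesgue S h" "(LINT x:S|lebesgue. h x) = (LINT x:S|lebesgue. f x)"
proof -
  show i: "set_integrable lebesgue S h"
    by (rule absolutely_integrable_spike[OF assms])
  have "integral S h = integral S f"
    by (rule integral_spike[OF assms(2)]) (use assms(3) in auto)
  then show "(LINT x:S|lebesgue. h x) = (LINT x:S|lebesgue. f x)"
    using set_lebesgue_integral_eq_integral(2)[OF i] set_lebesgue_integral_eq_integral(2)[OF assms(1)] by simp
qed

lemma locally_integrable_spike: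
  assumes "locally_integrable U g" "negligible N" "\<And>x. x \<in> U - N \<Longrightarrow> h x = g x"
  shows "locally_integrable U h"
  unfolding locally_integrable_def
proof (intro allI impI)
  fix K assume K: "compact K \<and> K \<subseteq> U"
  then have "g absolutely_integrable_on K"
    using assms(1) by (simp add: locally_integrable_def)
  then show "h absolutely_integrable_on K"
    by (rule absolutely_integrable_spike[OF _ assms(2)]) (use K assms(3) in auto)
qed

lemma has_weak_deriv_spike:
  assumes wd: "has_weak_deriv U v g" and N: "negligible N"
    and eq: "\<And>x. x \<in> U - N \<Longrightarrow> w x = v x" "\<And>x. x \<in> U - N \<Longrightarrow> h x = g x"
  shows "has_weak_deriv U w h"
  unfolding has_weak_deriv_def
proof (intro conjI ballI)
  show "locally_integrable U w" "locally_integrable U h"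
    using wd locally_integrable_spike[OF _ N] eq by (auto simp: has_weak_deriv_def)
  fix \<phi> assume \<phi>: "\<phi> \<in> test_functions U"
  have "(LINT x:U|lebesgue. w x * deriv \<phi> x) = (LINT x:U|lebesgue. v x * deriv \<phi> x)"
    by (rule set_integral_spike(2)[OF weak_deriv_integrable(1)[OF wd \<phi>] N]) (simp add: eq)
  also have "\<dots> = - (LINT x:U|lebesgue. g x * \<phi> x)"
    using wd \<phi> by (simp add: has_weak_deriv_def)
  also have "(LINT x:U|lebesgue. g x * \<phi> x) = (LINT x:U|lebesgue. h x * \<phi> x)"
    by (rule set_integral_spike(2)[OF weak_deriv_integrable(2)[OF wd \<phi>] N, symmetric]) (simp add: eq)
  finally show "(LINT x:U|lebesgue. w x * deriv \<phi> x) = - (LINT x:U|lebesgue. h x * \<phi> x)" .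
qed

lemma has_weak_deriv_weak_deriv: "has_weak_deriv U v g \<Longrightarrow> has_weak_deriv U v (weak_deriv U v)"
  using someI[of "has_weak_deriv U v" g] by (simp add: weak_deriv_def)

lemma AE_lebesgue_on_negligible:
  assumes "AE x in lebesgue_on U. P x" "U \<in> sets lebesgue"
  shows "negligible {x \<in> U. \<not> P x}"
proof -
  have "AE x in lebesgue. x \<in> U \<longrightarrow> P x"
    using assms by (simp add: AE_restrict_space_iff)
  then obtain N where "N \<in> null_sets lebesgue" "{x. \<not> (x \<in> U \<longrightarrow> P x)} \<subseteq> N"
    by (auto simp: eventually_ae_filter)
  then show ?thesis
    using negligible_subset[of N] by (auto simp: negligible_iff_null_sets)
qed

lemma negligible_AE_lebesgue_on:
  assumes "negligible N" "\<And>x. x \<in> U - N \<Longrightarrow> P x" "U \<in> sets lebesgue"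
  shows "AE x in lebesgue_on U. P x"
proof -
  have "AE x in lebesgue. x \<in> U \<longrightarrow> P x"
    using AE_not_in[of N lebesgue] assms(1,2)
    by (auto simp: negligible_iff_null_sets elim: eventually_mono)
  then show ?thesis
    using assms(3) by (simp add: AE_restrict_space_iff)
qed

lemma Linf_norm_leI:
  assumes "g \<in> borel_measurable (lebesgue_on U)"
    "AE x in lebesgue_on U. \<bar>g x\<bar> \<le> c"
  shows "Linf_norm U g \<le> ereal c"
  unfolding Linf_norm_def using assms by (intro esssup_I) auto

lemma Linf_norm_imp_AE:
  assumes "Linf_norm U g \<le> ereal c"
  shows "AE x in lebesgue_on U. \<bar>g x\<bar> \<le> c"
proof -
  have "AE x in lebesgue_on U. ereal \<bar>g x\<bar> \<le> Linf_norm U g"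
    unfolding Linf_norm_def by (rule esssup_AE)
  then show ?thesis
    by eventually_elim (use assms in \<open>metis ereal_less_eq(3) order_trans\<close>)
qed

text \<open>The points of \<open>U\<close> where the functions differ form an open null set, hence
  none exist; continuity carries the equality to the closure.\<close>

lemma continuous_AE_eq_imp_eq:
  fixes v r :: "real \<Rightarrow> real"
  assumes U: "open U" and c: "continuous_on (closure U) v" "continuous_on (closure U) r"
    and ae: "AE x in lebesgue_on U. v x = r x" and x: "x \<in> closure U"
  shows "v x = r x"
proof -
  have c': "continuous_on (closure U) (\<lambda>x. v x - r x)"
    by (intro continuous_intros c)
  have "open {x \<in> U. v x - r x \<in> - {0}}"
    by (rule continuous_open_preimage[OF continuous_on_subset[OF c' closure_subset] U, unfolded vimage_def Int_def mem_Collect_eq])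
       auto
  moreover have "negligible {x \<in> U. v x - r x \<in> - {0}}"
    using AE_lebesgue_on_negligible[OF ae] U by auto
  ultimately have "{x \<in> U. v x - r x \<in> - {0}} = {}"
    using open_not_negligible by blast
  then have "v x - r x = 0" if "x \<in> U" for x
    using that by auto
  from continuous_constant_on_closure[OF c' this x] show ?thesis by simp
qed

text \<open>\<open>W0_1inf\<close> speaks only of some continuous representative. An admissible
  function is itself continuous, so it agrees with that representative up to the frontier.\<close>

lemma admissible_zero_frontier:
  assumes "open A" "open B" "w \<in> admissible A B" "x \<in> frontier (A \<union> B)"
  shows "w x = 0"
proof -
  obtain r where "continuous_on (closure (A \<union> B)) r" "\<forall>x\<in>frontier (A \<union> B). r x = 0"
      "AE x in lebesgue_on (A \<union> B). w x = r x"
    using assms(3) by (auto simp: admissible_def W0_1inf_def)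
  moreover have "x \<in> closure (A \<union> B)" "open (A \<union> B)"
    using assms by (auto simp: frontier_def)
  moreover have "continuous_on (closure (A \<union> B)) w"
    using assms(3) by (simp add: admissible_def)
  ultimately show ?thesis
    using continuous_AE_eq_imp_eq[of "A \<union> B" w r x] assms(4) by metis
qed

text \<open>The chosen \<open>weak_deriv\<close> satisfies the gradient bound only almost
  everywhere. Replacing it by a measurable function bounded by 1 at every point makes the energy
  integrand plainly integrable.\<close>

lemma admissible_obtain_deriv:
  assumes "open A" "open B" "w \<in> admissible A B"
  obtains g where "has_weak_deriv (A \<union> B) w g" "g \<in> borel_measurable (lebesgue_on (A \<union> B))"
    "\<And>x. \<bar>g x\<bar> \<le> 1" "negligible {x \<in> A \<union> B. weak_deriv (A \<union> B) w x \<noteq> g x}"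
proof -
  define U where "U = A \<union> B"
  have U: "open U" "U \<in> sets lebesgue"
    using assms by (auto simp: U_def)
  obtain g where g: "g \<in> borel_measurable (lebesgue_on U)" "has_weak_deriv U w g"
    using assms(3) by (auto simp: admissible_def W0_1inf_def W1inf_def Linf_def U_def)
  define N where "N = {x \<in> U. weak_deriv U w x \<noteq> g x} \<union> {x \<in> U. \<not> \<bar>weak_deriv U w x\<bar> \<le> 1}"
  have "Linf_norm U (weak_deriv U w) \<le> ereal 1"
    using assms(3) by (simp add: admissible_def U_def one_ereal_def)
  then have N: "negligible N"
    unfolding N_def using has_weak_deriv_unique[OF U(1) has_weak_deriv_weak_deriv[OF g(2)] g(2)]
      AE_lebesgue_on_negligible[OF Linf_norm_imp_AE U(2)] by (intro negligible_Un)
  define h where "h x = (if \<bar>g x\<bar> \<le> 1 then g x else 0)" for x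
  have eq: "h x = g x" "weak_deriv U w x = h x" if "x \<in> U - N" for x
    using that by (auto simp: h_def N_def)
  have "has_weak_deriv U w h"
    by (rule has_weak_deriv_spike[OF g(2) N refl eq(1)])
  moreover have "h \<in> borel_measurable (lebesgue_on U)"
    unfolding h_def using g(1) by measurable
  moreover have "negligible {x \<in> U. weak_deriv U w x \<noteq> h x}"
    using eq(2) by (intro negligible_subset[OF N]) auto
  ultimately show ?thesis
    using that[of h] by (simp add: U_def h_def)
qed

definition energy_density :: "nat \<Rightarrow> real \<Rightarrow> real" where
  "energy_density k s = 1 / real k * exp (real k * (s\<^sup>2 - 1) / 2)"

text \<open>The tangent line inequality; the derivative of the density is the flux. It follows from
  exp r \<ge> 1 + r with r = k (t^2 - s^2) / 2, and from (t^2 - s^2) / 2 = s (t - s) + (t - s)^2 /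
  2.\<close>

lemma energy_density_convex:
  assumes "k \<ge> 1"
  shows "energy_density k t - energy_density k s \<ge> exp (real k * (s\<^sup>2 - 1) / 2) * s * (t - s)"
proof -
  define e where "e = exp (real k * (s\<^sup>2 - 1) / 2)"
  have "energy_density k t = e / real k * exp (real k * (t\<^sup>2 - s\<^sup>2) / 2)"
    by (simp add: energy_density_def e_def exp_add[symmetric] field_simps)
  also have "\<dots> \<ge> e / real k * (1 + real k * (t\<^sup>2 - s\<^sup>2) / 2)"
    unfolding e_def by (intro mult_left_mono exp_ge_add_one_self) auto
  also have "e / real k * (1 + real k * (t\<^sup>2 - s\<^sup>2) / 2) = energy_density k s + e * ((t\<^sup>2 - s\<^sup>2) / 2)"
    using assms by (simp add: energy_density_def e_def[symmetric] distrib_left)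
  finally have "energy_density k t - energy_density k s \<ge> e * ((t\<^sup>2 - s\<^sup>2) / 2)"
    by simp
  moreover have "e * ((t\<^sup>2 - s\<^sup>2) / 2) = e * s * (t - s) + e * (t - s)\<^sup>2 / 2"
    by (simp add: power2_eq_square field_simps)
  moreover have "e * (t - s)\<^sup>2 / 2 \<ge> 0"
    by (simp add: e_def)
  ultimately show ?thesis
    unfolding e_def by linarith
qed

lemma absolutely_integrable_bounded_measurable:
  fixes h :: "real \<Rightarrow> real"
  assumes "open U" "bounded U" "h \<in> borel_measurable (lebesgue_on U)" "\<And>x. \<bar>h x\<bar> \<le> c"
  shows "h absolutely_integrable_on U"
  by (rule measurable_bounded_by_integrable_imp_absolutely_integrable[where g="\<lambda>_. c"])
     (use assms in \<open>auto intro!: integrable_on_const bounded_set_imp_lmeasurable\<close>)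

text \<open>An end of one interval lying inside another open interval would force the two to overlap
  near that end.\<close>

lemma disjoint_intervals_endpoints:
  fixes p q :: "'i \<Rightarrow> real"
  assumes pq: "\<And>i. i \<in> I \<Longrightarrow> p i < q i"
    and disj: "\<And>i j. i \<in> I \<Longrightarrow> j \<in> I \<Longrightarrow> i \<noteq> j \<Longrightarrow> {p i<..<q i} \<inter> {p j<..<q j} = {}"
    and i: "i \<in> I"
  shows "p i \<notin> (\<Union>j\<in>I. {p j<..<q j})" "q i \<notin> (\<Union>j\<in>I. {p j<..<q j})"
proof -
  have unique: "i = j" if "j \<in> I" "t \<in> {p i<..<q i}" "t \<in> {p j<..<q j}" for j t
    using disj[OF i that(1)] that by blast
  show "p i \<notin> (\<Union>j\<in>I. {p j<..<q j})"
  proof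
    assume "p i \<in> (\<Union>j\<in>I. {p j<..<q j})"
    then obtain j where j: "j \<in> I" "p j < p i" "p i < q j"
      by auto
    then obtain t where "p i < t" "t < min (q i) (q j)"
      using dense[of "p i" "min (q i) (q j)"] pq[OF i] by auto
    then show False
      using unique[of j t] j by auto
  qed
  show "q i \<notin> (\<Union>j\<in>I. {p j<..<q j})"
  proof
    assume "q i \<in> (\<Union>j\<in>I. {p j<..<q j})"
    then obtain j where j: "j \<in> I" "p j < q i" "q i < q j"
      by auto
    then obtain t where "max (p i) (p j) < t" "t < q i"
      using dense[of "max (p i) (p j)" "q i"] pq[OF i] by auto
    then show False
      using unique[of j t] j by auto
  qed
qed

text \<open>The pieces may share an end, so the fluxes \<psi> live on closed pieces while \<Psi>
  glues them on the open ones and is 0 elsewhere. Likewise \<open>F\<close> continues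
  \<open>f\<close> from the open piece, since \<open>f\<close> may jump at an end. The balance
  condition is implicit: \<open>q i\<close> lies outside \<open>V\<close>, so \<open>u\<close> and
  \<open>u_off\<close> together make the slope integrate to 0 over each piece.\<close>

locale flux_pieces =
  fixes A B V :: "real set" and f u \<Psi> :: "real \<Rightarrow> real" and k :: nat and I :: "'i set" and p q :: "'i \<Rightarrow> real" and F \<psi> :: "'i \<Rightarrow> real \<Rightarrow> real"
    and U :: "real set"
  defines "U \<equiv> A \<union> B"
  assumes k: "k \<ge> 1" and open_AB: "open A" "open B" and bdd: "bounded A" "bounded B"
    and V_def: "V = U - closure (A \<inter> B)"
    and fin: "finite I" and pq: "\<And>i. i \<in> I \<Longrightarrow> p i < q i"
    and V_eq: "V = (\<Union>i\<in>I. {p i<..<q i})"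
    and disj: "\<And>i j. i \<in> I \<Longrightarrow> j \<in> I \<Longrightarrow> i \<noteq> j \<Longrightarrow> {p i<..<q i} \<inter> {p j<..<q j} = {}"
    and F: "\<And>i. i \<in> I \<Longrightarrow> continuous_on {p i..q i} (F i)"
    and f: "\<And>i x. i \<in> I \<Longrightarrow> x \<in> {p i<..<q i} \<Longrightarrow> f x = F i x"
    and \<psi>: "\<And>i x. i \<in> I \<Longrightarrow> x \<in> {p i..q i} \<Longrightarrow> (\<psi> i has_real_derivative - F i x) (at x within {p i..q i})"
    and \<psi>_le: "\<And>i x. i \<in> I \<Longrightarrow> x \<in> {p i..q i} \<Longrightarrow> \<bar>\<psi> i x\<bar> \<le> 1"
    and \<Psi>: "\<And>i x. i \<in> I \<Longrightarrow> x \<in> {p i<..<q i} \<Longrightarrow> \<Psi> x = \<psi> i x"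
    and \<Psi>_off: "\<And>x. x \<notin> V \<Longrightarrow> \<Psi> x = 0"
    and u: "\<And>i x. i \<in> I \<Longrightarrow> x \<in> {p i..q i} \<Longrightarrow> u x = integral {p i..x} (\<lambda>t. slope k (\<psi> i t))"
    and u_off: "\<And>x. x \<notin> V \<Longrightarrow> u x = 0"
begin

lemma U: "open U" "bounded U" "U \<in> sets lebesgue" "V \<subseteq> U" "open V"
  using open_AB bdd by (auto simp: U_def V_def open_Diff)

lemma piece_unique:
  "i \<in> I \<Longrightarrow> j \<in> I \<Longrightarrow> x \<in> {p i<..<q i} \<Longrightarrow> x \<in> {p j<..<q j} \<Longrightarrow> i = j"
  using disj by blast

lemma ends_notin:
  assumes "i \<in> I"
  shows "p i \<notin> V" "q i \<notin> V"
  unfolding V_eq by (rule disjoint_intervals_endpoints[where I=I, OF pq disj assms]; assumption)+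

lemma piece_subset: "i \<in> I \<Longrightarrow> {p i<..<q i} \<subseteq> U" "i \<in> I \<Longrightarrow> {p i..q i} \<subseteq> closure U"
proof -
  assume i: "i \<in> I"
  show s: "{p i<..<q i} \<subseteq> U"
    using i U(4) by (auto simp: V_eq)
  then show "{p i..q i} \<subseteq> closure U"
    using closure_mono[OF s] pq[OF i] by simp
qed

text \<open>\<Psi> and \<open>f\<close> are prescribed only on the open pieces; this passes to their
  continuous versions on the closed ones.\<close>

lemma spike_ends:
  fixes g h :: "real \<Rightarrow> real"
  assumes "i \<in> I" "\<And>x. x \<in> {p i<..<q i} \<Longrightarrow> h x = g x" "g absolutely_integrable_on {p i..q i}"
  shows "h absolutely_integrable_on {p i..q i}" "integral {p i..q i} h = integral {p i..q i} g"
proof -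
  have N: "negligible {p i, q i}" by simp
  have eq: "h x = g x" if "x \<in> {p i..q i} - {p i, q i}" for x
    using that by (intro assms(2)) auto
  show "h absolutely_integrable_on {p i..q i}"
    by (rule absolutely_integrable_spike[OF assms(3) N eq])
  show "integral {p i..q i} h = integral {p i..q i} g"
    by (rule integral_spike[OF N]) (use eq in auto)
qed

text \<open>Applied with \<open>S\<close> equal to \<open>U\<close> or \<open>V\<close>. Integrands
  carrying a factor \<open>u\<close>, \<Psi> or an admissible function vanish off \<open>V\<close>,
  so their integrals become sums over pieces.\<close>

lemma integral_pieces:
  fixes h :: "real \<Rightarrow> real"
  assumes h: "\<And>i. i \<in> I \<Longrightarrow> h absolutely_integrable_on {p i..q i}"
    and off: "\<And>x. x \<in> S \<Longrightarrow> x \<notin> V \<Longrightarrow> h x = 0" and S: "V \<subseteq> S"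
  shows "h absolutely_integrable_on S" "(LINT x:S|lebesgue. h x) = (\<Sum>i\<in>I. integral {p i..q i} h)"
proof -
  have hi: "integrable lebesgue (\<lambda>x. indicat_real {p i<..<q i} x *\<^sub>R h x)" if "i \<in> I" for i
    using h[OF that] unfolding absolutely_integrable_on_Icc_iff_Ioo by (simp add: set_integrable_def)
  have "indicat_real S x *\<^sub>R h x = (\<Sum>i\<in>I. indicat_real {p i<..<q i} x *\<^sub>R h x)" for x
  proof (cases "x \<in> V")
    case True
    then obtain j where j: "j \<in> I" "x \<in> {p j<..<q j}" by (auto simp: V_eq)
    have "(\<Sum>i\<in>I. indicat_real {p i<..<q i} x *\<^sub>R h x) = (\<Sum>i\<in>I. if i = j then h x else 0)"
    proof (rule sum.cong[OF refl])
      fix i assume "i \<in> I"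
      then have "x \<in> {p i<..<q i} \<longleftrightarrow> i = j"
        using piece_unique j by blast
      then show "indicat_real {p i<..<q i} x *\<^sub>R h x = (if i = j then h x else 0)"
        by (simp add: indicator_def del: greaterThanLessThan_iff)
    qed
    then show ?thesis
      using fin j S True by auto
  next
    case False
    then have "(\<Sum>i\<in>I. indicat_real {p i<..<q i} x *\<^sub>R h x) = 0"
      by (intro sum.neutral) (auto simp: V_eq indicator_def)
    then show ?thesis
      using off[of x] False by (simp add: indicator_def)
  qed
  then have eq: "(\<lambda>x. indicat_real S x *\<^sub>R h x) = (\<lambda>x. \<Sum>i\<in>I. indicat_real {p i<..<q i} x *\<^sub>R h x)"
    by blast
  show "h absolutely_integrable_on S"
    unfolding set_integrable_def eq using hi by (intro Bochner_Integration.integrable_sum) auto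
  have "(LINT x:S|lebesgue. h x) = (\<Sum>i\<in>I. LINT x:{p i<..<q i}|lebesgue. h x)"
    unfolding set_lebesgue_integral_def eq using hi by (intro Bochner_Integration.integral_sum) auto
  also have "\<dots> = (\<Sum>i\<in>I. integral {p i..q i} h)"
  proof (rule sum.cong[OF refl])
    fix i assume "i \<in> I"
    then show "(LINT x:{p i<..<q i}|lebesgue. h x) = integral {p i..q i} h"
      using set_lebesgue_integral_eq_integral(2)[OF h[unfolded absolutely_integrable_on_Icc_iff_Ioo]]
      by (simp add: integral_open_interval_real)
  qed
  finally show "(LINT x:S|lebesgue. h x) = (\<Sum>i\<in>I. integral {p i..q i} h)" .
qed

lemma \<Psi>_le: "\<bar>\<Psi> x\<bar> \<le> 1"
  using \<Psi> \<psi>_le \<Psi>_off[of x] by (cases "x \<in> V") (auto simp: V_eq)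

lemma \<psi>_continuous: "i \<in> I \<Longrightarrow> continuous_on {p i..q i} (\<psi> i)"
  using \<psi> by (rule DERIV_continuous_on)

lemma slope_\<psi>_continuous: "i \<in> I \<Longrightarrow> continuous_on {p i..q i} (\<lambda>t. slope k (\<psi> i t))"
  using \<psi>_le by (intro continuous_on_compose2[OF slope_continuous_on[OF k] \<psi>_continuous])
    (auto simp: abs_le_iff minus_le_iff)

text \<open>Gluing along two closed sets: the finite union of closed pieces, where \<open>u\<close>
  is an indefinite integral, and the complement of \<open>V\<close>, where it is 0.\<close>

lemma u_continuous: "continuous_on UNIV u"
proof -
  have "continuous_on {p i..q i} u" if i: "i \<in> I" for i
    by (rule continuous_on_eq[OF indefinite_integral_continuous_1[OF integrable_continuous_real[OF slope_\<psi>_continuous[OF i]]]])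
       (simp add: u[OF i])
  then have "continuous_on (\<Union>i\<in>I. {p i..q i}) u"
    using fin by (intro continuous_on_closed_Union) auto
  moreover have "continuous_on (- V) u"
    using u_off by (intro continuous_on_eq[OF continuous_on_const[of _ 0]]) auto
  moreover have "closed (- V)" "closed (\<Union>i\<in>I. {p i..q i})"
    using U(5) fin by auto
  moreover have "(\<Union>i\<in>I. {p i..q i}) \<union> - V = UNIV"
    by (force simp: V_eq)
  ultimately show ?thesis
    using continuous_on_closed_Un[of "\<Union>i\<in>I. {p i..q i}" "- V" u] by simp
qed

lemma slope_\<Psi>: "i \<in> I \<Longrightarrow> (\<lambda>x. slope k (\<Psi> x)) absolutely_integrable_on {p i..q i}"
  by (rule spike_ends(1)[OF _ _ absolutely_integrable_continuous_real[OF slope_\<psi>_continuous]]) (auto simp: \<Psi>)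

lemma slope_\<Psi>_integrable: "V \<subseteq> S \<Longrightarrow> (\<lambda>x. slope k (\<Psi> x)) absolutely_integrable_on S"
  by (rule integral_pieces(1)[OF slope_\<Psi>]) (auto simp: \<Psi>_off slope_0)

lemma u_integrable: "V \<subseteq> S \<Longrightarrow> u absolutely_integrable_on S"
  by (rule integral_pieces(1)[OF absolutely_integrable_continuous_real[OF continuous_on_subset[OF u_continuous]]])
     (auto simp: u_off)

text \<open>Integration by parts on each piece. A test function on \<open>U\<close> need not vanish
  at the ends of a piece, for instance at the boundary of the overlap, but \<open>u\<close> does.
  Kinks of \<open>u\<close> there are harmless.\<close>

lemma has_weak_deriv_u: "has_weak_deriv U u (\<lambda>x. slope k (\<Psi> x))"
  unfolding has_weak_deriv_def
proof (intro conjI ballI)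
  show "locally_integrable U u"
    unfolding locally_integrable_def
    using set_integrable_subset[OF u_integrable[OF U(4)]] by (auto simp: compact_imp_closed)
  show "locally_integrable U (\<lambda>x. slope k (\<Psi> x))"
    unfolding locally_integrable_def
    using set_integrable_subset[OF slope_\<Psi>_integrable[OF U(4)]] by (auto simp: compact_imp_closed)
  fix \<phi> assume \<phi>: "\<phi> \<in> test_functions U"
  have s: "smooth \<phi>" by (rule test_functions_smooth[OF \<phi>])
  have c: "continuous_on X \<phi>" "continuous_on X (deriv \<phi>)" "continuous_on X u" for X
    using smooth_continuous_on s smooth_deriv u_continuous continuous_on_subset by blast+
  have "(LINT x:U|lebesgue. u x * deriv \<phi> x) = (\<Sum>i\<in>I. integral {p i..q i} (\<lambda>x. u x * deriv \<phi> x))"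
    by (rule integral_pieces(2)) (auto simp: u_off U(4)[THEN subsetD] intro!: absolutely_integrable_continuous_real continuous_intros c)
  also have "\<dots> = (\<Sum>i\<in>I. - integral {p i..q i} (\<lambda>x. slope k (\<Psi> x) * \<phi> x))"
  proof (rule sum.cong[OF refl])
    fix i assume i: "i \<in> I"
    have "integral {p i..q i} (\<lambda>x. \<phi> x * slope k (\<psi> i x)) + integral {p i..q i} (\<lambda>x. deriv \<phi> x * u x)
        = \<phi> (q i) * u (q i) - \<phi> (p i) * u (p i)"
    proof (rule integration_by_parts_indefinite_integral)
      show "u x = u (p i) + integral {p i..x} (\<lambda>t. slope k (\<psi> i t))" if "x \<in> {p i..q i}" for x
        using u[OF i that] u[OF i, of "p i"] pq[OF i] by simp
    qed (use pq[OF i] c s slope_\<psi>_continuous[OF i] in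
        \<open>auto intro: absolutely_integrable_continuous_real has_field_derivative_at_within smooth_imp_DERIV\<close>)
    also have "\<dots> = 0"
      using ends_notin[OF i] u_off by simp
    also have "integral {p i..q i} (\<lambda>x. \<phi> x * slope k (\<psi> i x)) = integral {p i..q i} (\<lambda>x. slope k (\<Psi> x) * \<phi> x)"
      by (rule spike_ends(2)[OF i, symmetric])
         (auto simp: \<Psi>[OF i] intro!: absolutely_integrable_continuous_real continuous_intros c slope_\<psi>_continuous[OF i])
    finally show "integral {p i..q i} (\<lambda>x. u x * deriv \<phi> x) = - integral {p i..q i} (\<lambda>x. slope k (\<Psi> x) * \<phi> x)"
      by (simp add: mult.commute)
  qed
  also have "\<dots> = - (LINT x:U|lebesgue. slope k (\<Psi> x) * \<phi> x)"
    by (subst integral_pieces(2)[OF _ _ U(4)])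
       (auto simp: \<Psi>_off slope_0 sum_negf intro!: absolutely_integrable_mult_continuous[OF slope_\<Psi>] c)
  finally show "(LINT x:U|lebesgue. u x * deriv \<phi> x) = - (LINT x:U|lebesgue. slope k (\<Psi> x) * \<phi> x)" .
qed

lemma weak_deriv_u: "negligible {x \<in> U. weak_deriv U u x \<noteq> slope k (\<Psi> x)}"
  by (rule has_weak_deriv_unique[OF U(1) has_weak_deriv_weak_deriv[OF has_weak_deriv_u] has_weak_deriv_u])

lemma slope_\<Psi>_le: "\<bar>slope k (\<Psi> x)\<bar> \<le> 1"
  by (rule slope_props(1)[OF k \<Psi>_le])

lemma flux_slope: "exp (real k * ((slope k (\<Psi> x))\<^sup>2 - 1) / 2) * slope k (\<Psi> x) = \<Psi> x"
  by (rule slope_props(2)[OF k \<Psi>_le])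

lemma slope_\<Psi>_measurable: "(\<lambda>x. slope k (\<Psi> x)) \<in> borel_measurable (lebesgue_on U)"
  using slope_\<Psi>_integrable[OF U(4)] U(3) by (rule absolutely_integrable_imp_borel_measurable)

lemma u_zero: "x \<in> frontier U \<Longrightarrow> u x = 0" "x \<in> closure (A \<inter> B) \<Longrightarrow> u x = 0" "x \<in> frontier V \<Longrightarrow> u x = 0"
  using U by (auto simp: V_def frontier_def interior_open intro!: u_off)

lemma u_admissible: "u \<in> admissible A B"
proof -
  have cl: "continuous_on (closure U) u"
    using u_continuous continuous_on_subset by blast
  have "compact (closure U)"
    using U(2) by simp
  then obtain c where c: "\<And>x. x \<in> closure U \<Longrightarrow> \<bar>u x\<bar> \<le> c"
    using compact_imp_bounded[OF compact_continuous_image[OF cl]] by (force simp: bounded_iff)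
  have um: "u \<in> borel_measurable (lebesgue_on U)"
    using U(3) u_continuous continuous_on_subset
    by (intro continuous_imp_measurable_on_sets_lebesgue) auto
  have "AE x in lebesgue_on U. \<bar>u x\<bar> \<le> c"
    using c closure_subset by (intro negligible_AE_lebesgue_on[of "{}"] U(3)) auto
  then have "Linf_norm U u \<le> ereal c"
    using um by (intro Linf_norm_leI)
  then have u1: "u \<in> Linf U"
    using um by (auto simp: Linf_def intro: le_less_trans)
  have "Linf_norm U (\<lambda>x. slope k (\<Psi> x)) \<le> ereal 1"
    by (rule Linf_norm_leI[OF slope_\<Psi>_measurable]) (simp add: slope_\<Psi>_le)
  then have g1: "(\<lambda>x. slope k (\<Psi> x)) \<in> Linf U"
    using slope_\<Psi>_measurable by (auto simp: Linf_def intro: le_less_trans)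
  have eq: "weak_deriv U u x = slope k (\<Psi> x)" if "x \<in> U - {x \<in> U. weak_deriv U u x \<noteq> slope k (\<Psi> x)}" for x
    using that by auto
  \<comment> \<open>\<open>Linf_norm_leI\<close> asks for measurability, which the arbitrary choice
    \<open>weak_deriv U u\<close> inherits from the slope it equals almost everywhere.\<close>
  have "weak_deriv U u absolutely_integrable_on U"
    by (rule absolutely_integrable_spike[OF slope_\<Psi>_integrable[OF U(4)] weak_deriv_u eq])
  then have "weak_deriv U u \<in> borel_measurable (lebesgue_on U)"
    using U(3) by (rule absolutely_integrable_imp_borel_measurable)
  moreover have "AE x in lebesgue_on U. \<bar>weak_deriv U u x\<bar> \<le> 1"
    by (rule negligible_AE_lebesgue_on[OF weak_deriv_u _ U(3)]) (auto simp: slope_\<Psi>_le)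
  ultimately have "Linf_norm U (weak_deriv U u) \<le> 1"
    using Linf_norm_leI by (metis one_ereal_def)
  then show ?thesis
    using u1 g1 has_weak_deriv_u cl u_zero unfolding admissible_def W0_1inf_def W1inf_def U_def[symmetric]
    by auto
qed

text \<open>The equation is first shown for \<Psi>, which equals the flux of \<open>u\<close> off a
  null set. Here the boundary terms vanish because of the test function: its support lies in
  \<open>V\<close>, which contains no end of a piece. The flux itself may be nonzero there.\<close>

lemma euler_lagrange: "euler_lagrange_solution k U V f u"
  unfolding euler_lagrange_solution_def
proof (intro conjI ballI)
  show "u x = 0" if "x \<in> frontier V" for x
    by (rule u_zero(3)[OF that])
  have \<Psi>i: "\<Psi> absolutely_integrable_on {p i..q i}" if "i \<in> I" for i
    by (rule spike_ends(1)[OF that _ absolutely_integrable_continuous_real[OF \<psi>_continuous[OF that]]]) (simp add: \<Psi>[OF that])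
  have fi: "f absolutely_integrable_on {p i..q i}" if "i \<in> I" for i
    by (rule spike_ends(1)[OF that _ absolutely_integrable_continuous_real[OF F[OF that]]]) (simp add: f[OF that])
  have fV: "f absolutely_integrable_on V" and \<Psi>V: "\<Psi> absolutely_integrable_on V"
    using integral_pieces(1)[OF fi] integral_pieces(1)[OF \<Psi>i] by auto
  let ?W = "\<lambda>x. exp (real k * ((weak_deriv U u x)\<^sup>2 - 1) / 2) * weak_deriv U u x"
  have "has_weak_deriv V \<Psi> (\<lambda>x. - f x)"
    unfolding has_weak_deriv_def
  proof (intro conjI ballI)
    show "locally_integrable V \<Psi>" "locally_integrable V (\<lambda>x. - f x)"
      unfolding locally_integrable_def
      using set_integrable_subset[OF \<Psi>V] set_integrable_subset[OF fV] by (auto simp: compact_imp_closed set_integrable_def)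
    fix \<phi> assume \<phi>: "\<phi> \<in> test_functions V"
    have s: "smooth \<phi>" by (rule test_functions_smooth[OF \<phi>])
    have c: "continuous_on X \<phi>" "continuous_on X (deriv \<phi>)" for X
      using smooth_continuous_on s smooth_deriv by blast+
    have "(LINT x:V|lebesgue. \<Psi> x * deriv \<phi> x) = (\<Sum>i\<in>I. integral {p i..q i} (\<lambda>x. \<Psi> x * deriv \<phi> x))"
      by (rule integral_pieces(2)) (auto intro!: absolutely_integrable_mult_continuous[OF \<Psi>i] c)
    also have "\<dots> = (\<Sum>i\<in>I. integral {p i..q i} (\<lambda>x. f x * \<phi> x))"
    proof (rule sum.cong[OF refl])
      fix i assume i: "i \<in> I"
      have "integral {p i..q i} (\<lambda>x. \<psi> i x * deriv \<phi> x) + integral {p i..q i} (\<lambda>x. - F i x * \<phi> x)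
          = \<psi> i (q i) * \<phi> (q i) - \<psi> i (p i) * \<phi> (p i)"
      proof (rule integration_by_parts_indefinite_integral)
        show "\<phi> x = \<phi> (p i) + integral {p i..x} (deriv \<phi>)" if "x \<in> {p i..q i}" for x
        proof -
          have "(deriv \<phi> has_integral \<phi> x - \<phi> (p i)) {p i..x}"
            using that s by (intro fundamental_theorem_of_calculus)
              (auto simp: has_real_derivative_iff_has_vector_derivative[symmetric]
                 intro: has_field_derivative_at_within smooth_imp_DERIV)
          then show ?thesis by (simp add: integral_unique)
        qed
      qed (use pq[OF i] c s \<psi>[OF i] F[OF i] in
          \<open>auto intro!: absolutely_integrable_continuous_real continuous_intros\<close>)
      also have "\<dots> = 0"
        using ends_notin[OF i] test_functions_support[OF \<phi>] by (metis diff_self mult_zero_right subsetD)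
      finally have "integral {p i..q i} (\<lambda>x. \<psi> i x * deriv \<phi> x) = integral {p i..q i} (\<lambda>x. F i x * \<phi> x)"
        by simp
      moreover have "integral {p i..q i} (\<lambda>x. \<Psi> x * deriv \<phi> x) = integral {p i..q i} (\<lambda>x. \<psi> i x * deriv \<phi> x)"
        by (rule spike_ends(2)[OF i]) (auto simp: \<Psi>[OF i] intro!: absolutely_integrable_continuous_real continuous_intros c \<psi>_continuous[OF i])
      moreover have "integral {p i..q i} (\<lambda>x. f x * \<phi> x) = integral {p i..q i} (\<lambda>x. F i x * \<phi> x)"
        by (rule spike_ends(2)[OF i]) (auto simp: f[OF i] intro!: absolutely_integrable_continuous_real continuous_intros c F[OF i])
      ultimately show "integral {p i..q i} (\<lambda>x. \<Psi> x * deriv \<phi> x) = integral {p i..q i} (\<lambda>x. f x * \<phi> x)"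
        by simp
    qed
    also have "\<dots> = (LINT x:V|lebesgue. f x * \<phi> x)"
      by (rule integral_pieces(2)[symmetric]) (auto intro!: absolutely_integrable_mult_continuous[OF fi] c)
    finally show "(LINT x:V|lebesgue. \<Psi> x * deriv \<phi> x) = - (LINT x:V|lebesgue. - f x * \<phi> x)"
      by (simp add: set_lebesgue_integral_def)
  qed
  then show "has_weak_deriv V ?W (\<lambda>x. - f x)"
  proof (rule has_weak_deriv_spike[OF _ weak_deriv_u])
    fix x assume "x \<in> V - {x \<in> U. weak_deriv U u x \<noteq> slope k (\<Psi> x)}"
    then have "weak_deriv U u x = slope k (\<Psi> x)"
      using U(4) by auto
    then show "?W x = \<Psi> x"
      by (simp only: flux_slope)
  qed simp
qed

text \<open>Exchanges the chosen derivative for a bounded one and secures integrability, without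
  which the integral in \<open>energy\<close> carries no information. The product of
  \<open>w\<close> and \<open>f\<close> lives on \<open>V\<close>, because \<open>w\<close> is 0 on
  the closed overlap.\<close>

lemma energy_eq:
  assumes w: "w \<in> admissible A B"
    and g: "g \<in> borel_measurable (lebesgue_on U)" "\<And>x. \<bar>g x\<bar> \<le> 1" "negligible {x \<in> U. weak_deriv U w x \<noteq> g x}"
  shows "(\<lambda>x. energy_density k (g x) - w x * f x) absolutely_integrable_on U"
    and "energy k U f w = (LINT x:U|lebesgue. energy_density k (g x) - w x * f x)"
proof -
  have cw: "continuous_on {p i..q i} w" if "i \<in> I" for i
    using w piece_subset(2)[OF that] by (auto simp: admissible_def U_def intro: continuous_on_subset)
  have wfi: "(\<lambda>x. w x * f x) absolutely_integrable_on {p i..q i}" if i: "i \<in> I" for i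
    by (rule spike_ends(1)[OF i _ absolutely_integrable_continuous_real[OF continuous_on_mult[OF cw[OF i] F[OF i]]]])
       (simp add: f[OF i])
  have wf0: "w x * f x = 0" if "x \<in> U" "x \<notin> V" for x
    using w that by (auto simp: admissible_def V_def)
  have wf: "(\<lambda>x. w x * f x) absolutely_integrable_on U"
    by (rule integral_pieces(1)[where h="\<lambda>x. w x * f x", OF wfi wf0 U(4)])
  have "continuous_on UNIV (energy_density k)"
    unfolding energy_density_def by (intro continuous_intros) auto
  from borel_measurable_continuous_on[OF this g(1)]
  have m: "(\<lambda>x. energy_density k (g x)) \<in> borel_measurable (lebesgue_on U)" .
  have "\<bar>energy_density k s\<bar> \<le> 1 / real k" if "\<bar>s\<bar> \<le> 1" for s
  proof -
    have "s\<^sup>2 \<le> 1"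
      using that by (simp only: abs_square_le_1)
    then have "real k * (s\<^sup>2 - 1) \<le> 0"
      by (intro mult_nonneg_nonpos) auto
    then have "exp (real k * (s\<^sup>2 - 1) / 2) \<le> 1"
      by simp
    then show ?thesis
      using mult_left_mono[of "exp (real k * (s\<^sup>2 - 1) / 2)" 1 "1 / real k"] by (simp add: energy_density_def)
  qed
  then have "(\<lambda>x. energy_density k (g x)) absolutely_integrable_on U"
    using g(2) by (intro absolutely_integrable_bounded_measurable[OF U(1,2) m]) auto
  then show i: "(\<lambda>x. energy_density k (g x) - w x * f x) absolutely_integrable_on U"
    using wf by (rule set_integral_diff(1))
  have "energy k U f w = (LINT x:U|lebesgue. energy_density k (weak_deriv U w x) - w x * f x)"
    by (simp add: energy_def energy_density_def)
  also have "\<dots> = (LINT x:U|lebesgue. energy_density k (g x) - w x * f x)"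
    by (rule set_integral_spike(2)[OF i g(3)]) auto
  finally show "energy k U f w = (LINT x:U|lebesgue. energy_density k (g x) - w x * f x)" .
qed

text \<open>The first variation of the energy at \<open>u\<close> in direction \<open>z\<close>.
  Since \<psi> has derivative \<open>- F i\<close>, the integrand on a piece is formally the
  derivative of the product of \<psi> and \<open>z\<close>, whose end values are 0.\<close>

lemma flux_orthogonal:
  fixes z g :: "real \<Rightarrow> real"
  assumes wd: "has_weak_deriv U z g" and g: "g absolutely_integrable_on U"
    and z: "continuous_on (closure U) z" "\<And>i. i \<in> I \<Longrightarrow> z (p i) = 0" "\<And>i. i \<in> I \<Longrightarrow> z (q i) = 0"
    and z_off: "\<And>x. x \<in> U \<Longrightarrow> x \<notin> V \<Longrightarrow> z x = 0"
  shows "(\<lambda>x. \<Psi> x * g x - z x * f x) absolutely_integrable_on U"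
    and "(LINT x:U|lebesgue. \<Psi> x * g x - z x * f x) = 0"
proof -
  let ?h = "\<lambda>x. \<Psi> x * g x - z x * f x"
  have main: "?h absolutely_integrable_on {p i..q i} \<and> integral {p i..q i} ?h = 0" if i: "i \<in> I" for i
  proof -
    have gi: "g absolutely_integrable_on {p i..q i}"
      unfolding absolutely_integrable_on_Icc_iff_Ioo
      by (rule set_integrable_subset[OF g _ piece_subset(1)[OF i]]) auto
    then have gi': "g integrable_on {p i..q i}"
      by (rule set_lebesgue_integral_eq_integral(1))
    have cz: "continuous_on {p i..q i} z"
      using z(1) piece_subset(2)[OF i] by (rule continuous_on_subset)
    have zi: "z x = z (p i) + integral {p i..x} g" if x: "x \<in> {p i..q i}" for x
    proof -
      define m where "m = (p i + q i) / 2"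
      have m: "m \<in> {p i<..<q i}" using pq[OF i] by (simp add: m_def)
      \<comment> \<open>The fundamental theorem applies to compact subintervals of \<open>U\<close>,
        but the ends of the piece may lie on its frontier. So the defect is shown constant inside
        and continued to the ends.\<close>
      let ?d = "\<lambda>x. z x - integral {p i..x} g"
      have cd: "continuous_on (closure {p i<..<q i}) ?d"
        using pq[OF i] cz gi' by (simp, intro continuous_intros indefinite_integral_continuous_1)
      have step: "?d t = ?d s" if "p i < s" "s \<le> t" "t < q i" for s t
      proof -
        have "z t - z s = integral {s..t} g"
          using that piece_subset(1)[OF i] z(1) closure_subset
          by (intro has_weak_deriv_imp_integral[OF U(1) wd]) (auto intro: continuous_on_subset)
        moreover have "integral {p i..s} g + integral {s..t} g = integral {p i..t} g"
          using that by (intro Henstock_Kurzweil_Integration.integral_combine integrable_on_subinterval[OF gi']) auto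
        ultimately show ?thesis by simp
      qed
      have "?d y = ?d m" if "y \<in> {p i<..<q i}" for y
        using that m step[of y m] step[of m y] by (cases "y \<le> m") auto
      from continuous_constant_on_closure[OF cd this] have "?d y = ?d m" if "y \<in> {p i..q i}" for y
        using that pq[OF i] by simp
      from this[of x] this[of "p i"] show ?thesis
        using x pq[OF i] by simp
    qed
    have "integral {p i..q i} (\<lambda>x. \<psi> i x * g x) + integral {p i..q i} (\<lambda>x. - F i x * z x)
        = \<psi> i (q i) * z (q i) - \<psi> i (p i) * z (p i)"
      by (rule integration_by_parts_indefinite_integral[OF less_imp_le[OF pq[OF i]] gi zi \<psi>[OF i]
            continuous_on_minus[OF F[OF i]]])
    then have eq: "integral {p i..q i} (\<lambda>x. \<psi> i x * g x) + integral {p i..q i} (\<lambda>x. - F i x * z x) = 0"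
      using z(2,3)[OF i] by simp
    have a1: "(\<lambda>x. \<psi> i x * g x) absolutely_integrable_on {p i..q i}"
      using absolutely_integrable_mult_continuous[OF gi \<psi>_continuous[OF i]] by (simp add: mult.commute)
    have a2: "(\<lambda>x. - F i x * z x) absolutely_integrable_on {p i..q i}"
      by (intro absolutely_integrable_continuous_real continuous_intros F[OF i] cz)
    have a: "(\<lambda>x. \<psi> i x * g x + - F i x * z x) absolutely_integrable_on {p i..q i}"
      by (rule set_integral_add(1)[OF a1 a2])
    have "integral {p i..q i} (\<lambda>x. \<psi> i x * g x + - F i x * z x) = 0"
      using eq Henstock_Kurzweil_Integration.integral_add[OF set_lebesgue_integral_eq_integral(1)[OF a1]
          set_lebesgue_integral_eq_integral(1)[OF a2]] by simp
    moreover have e: "?h x = \<psi> i x * g x + - F i x * z x" if "x \<in> {p i<..<q i}" for x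
      using that by (simp add: \<Psi>[OF i] f[OF i])
    ultimately show ?thesis
      using spike_ends[OF i e a] by simp
  qed
  have off: "?h x = 0" if "x \<in> U" "x \<notin> V" for x
    using that by (simp add: \<Psi>_off z_off)
  show "?h absolutely_integrable_on U" "(LINT x:U|lebesgue. ?h x) = 0"
    using integral_pieces[of ?h U] main off U(4) by auto
qed

lemma energy_minimal:
  assumes w: "w \<in> admissible A B"
  shows "energy k U f u \<le> energy k U f w"
proof -
  obtain g where g: "has_weak_deriv U w g" "g \<in> borel_measurable (lebesgue_on U)"
    "\<And>x. \<bar>g x\<bar> \<le> 1" "negligible {x \<in> U. weak_deriv U w x \<noteq> g x}"
    using admissible_obtain_deriv[OF open_AB w] by (auto simp: U_def)
  have gi: "g absolutely_integrable_on U"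
    using g(3) by (rule absolutely_integrable_bounded_measurable[OF U(1,2) g(2)])
  \<comment> \<open>The two constraints together cover every point outside \<open>V\<close>: inside
    \<open>U\<close> it belongs to the closed overlap, otherwise to the frontier.\<close>
  have w0: "w x = 0" if "x \<in> closure U" "x \<notin> V" for x
  proof (cases "x \<in> U")
    case True
    then show ?thesis
      using w that by (auto simp: admissible_def V_def)
  next
    case False
    then have "x \<in> frontier U"
      using that(1) U(1) by (simp add: frontier_def interior_open)
    then show ?thesis
      using admissible_zero_frontier[OF open_AB w] by (simp add: U_def)
  qed
  have cw: "continuous_on (closure U) w"
    using w by (simp add: admissible_def U_def)
  let ?g = "\<lambda>x. g x - slope k (\<Psi> x)" and ?z = "\<lambda>x. w x - u x"
  have ends: "p i \<in> closure U" "q i \<in> closure U" if "i \<in> I" for i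
    using piece_subset(2)[OF that] pq[OF that] by auto
  have wd: "has_weak_deriv U ?z ?g"
    by (rule has_weak_deriv_diff[OF g(1) has_weak_deriv_u])
  have gd: "?g absolutely_integrable_on U"
    by (rule set_integral_diff(1)[OF gi slope_\<Psi>_integrable[OF U(4)]])
  have cz: "continuous_on (closure U) ?z"
    by (intro continuous_intros cw continuous_on_subset[OF u_continuous subset_UNIV])
  have z0: "i \<in> I \<Longrightarrow> ?z (p i) = 0" "i \<in> I \<Longrightarrow> ?z (q i) = 0" "x \<in> U \<Longrightarrow> x \<notin> V \<Longrightarrow> ?z x = 0" for i x
    using w0 ends ends_notin u_off subsetD[OF closure_subset[of U]] by auto
  have orth: "(\<lambda>x. \<Psi> x * ?g x - ?z x * f x) absolutely_integrable_on U"
    "(LINT x:U|lebesgue. \<Psi> x * ?g x - ?z x * f x) = 0"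
    using flux_orthogonal[OF wd gd cz z0] by simp_all
  note ew = energy_eq[OF w g(2-4)]
  note eu = energy_eq[OF u_admissible slope_\<Psi>_measurable slope_\<Psi>_le weak_deriv_u]
  have "(LINT x:U|lebesgue. \<Psi> x * ?g x - ?z x * f x) \<le>
      (LINT x:U|lebesgue. (energy_density k (g x) - w x * f x) - (energy_density k (slope k (\<Psi> x)) - u x * f x))"
  proof (rule set_integral_mono[OF orth(1) set_integral_diff(1)[OF ew(1) eu(1)]])
    fix x
    \<comment> \<open>By \<open>flux_slope\<close> the coefficient of the tangent line at the slope
      of \<open>u\<close> is exactly \<Psi>, so the lower bound integrates to the first
      variation.\<close>
    have "\<Psi> x * ?g x \<le> energy_density k (g x) - energy_density k (slope k (\<Psi> x))"
      using energy_density_convex[OF k, of "slope k (\<Psi> x)" "g x"] unfolding flux_slope .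
    then show "\<Psi> x * ?g x - ?z x * f x \<le> (energy_density k (g x) - w x * f x) - (energy_density k (slope k (\<Psi> x)) - u x * f x)"
      by (simp add: algebra_simps)
  qed
  also have "\<dots> = energy k U f w - energy k U f u"
    unfolding ew(2) eu(2) by (rule set_integral_diff(2)[OF ew(1) eu(1)])
  finally show ?thesis
    unfolding orth(2) by simp
qed

lemma u_minimizer: "is_arg_min (energy k U f) (\<lambda>w. w \<in> admissible A B) u"
  using u_admissible energy_minimal by (auto simp: is_arg_min_def not_less)

end

section \<open>Existence and explicit representation\<close>

lemma integral_positive_mono:
  fixes g :: "real \<Rightarrow> real"
  assumes g: "continuous_on {p..q} g" and pos: "\<And>x. x \<in> {p<..<q} \<Longrightarrow> g x > 0"
    and st: "p \<le> s" "s \<le> t" "t \<le> q"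
  shows "0 \<le> integral {s..t} g" "integral {s..t} g \<le> integral {p..q} g"
proof -
  have nonneg: "0 \<le> integral {x..y} g" if "p \<le> x" "x \<le> y" "y \<le> q" for x y
    using integral_less_real[of x y "\<lambda>_. 0" g] that pos continuous_on_subset[OF g, of "{x..y}"]
    by (cases "x = y") auto
  then show "0 \<le> integral {s..t} g"
    using st by blast
  have i: "g integrable_on {p..q}"
    using g by (rule integrable_continuous_real)
  have "integral {p..s} g + integral {s..q} g = integral {p..q} g"
    using st by (intro Henstock_Kurzweil_Integration.integral_combine i) auto
  moreover have "integral {s..t} g + integral {t..q} g = integral {s..q} g"
    using st by (intro Henstock_Kurzweil_Integration.integral_combine integrable_on_subinterval[OF i]) auto
  ultimately show "integral {s..t} g \<le> integral {p..q} g"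
    using nonneg[of p s] nonneg[of t q] st by simp
qed

text \<open>\<sigma> records the sign of \<open>f\<close> on each piece. As \<open>slope\<close> is
  odd, one balancing lemma for positive densities serves both signs.\<close>

lemma exists_obstacle_solution:
  fixes A B :: "real set" and f :: "real \<Rightarrow> real" and I :: "'i set" and p q \<sigma> :: "'i \<Rightarrow> real" and g :: "'i \<Rightarrow> real \<Rightarrow> real"
  assumes k: "k \<ge> 1" and AB: "open A" "open B" "bounded A" "bounded B"
    and fin: "finite I" and pq: "\<And>i. i \<in> I \<Longrightarrow> p i < q i"
    and V: "(A \<union> B) - closure (A \<inter> B) = (\<Union>i\<in>I. {p i<..<q i})"
    and disj: "\<And>i j. i \<in> I \<Longrightarrow> j \<in> I \<Longrightarrow> i \<noteq> j \<Longrightarrow> {p i<..<q i} \<inter> {p j<..<q j} = {}"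
    and g: "\<And>i. i \<in> I \<Longrightarrow> continuous_on {p i..q i} (g i)"
    and pos: "\<And>i x. i \<in> I \<Longrightarrow> x \<in> {p i<..<q i} \<Longrightarrow> g i x > 0"
    and le1: "\<And>i. i \<in> I \<Longrightarrow> integral {p i..q i} (g i) \<le> 1"
    and \<sigma>: "\<And>i. i \<in> I \<Longrightarrow> \<sigma> i \<in> {1, -1}"
    and f: "\<And>i x. i \<in> I \<Longrightarrow> x \<in> {p i<..<q i} \<Longrightarrow> f x = \<sigma> i * g i x"
  obtains u C where "\<And>i. i \<in> I \<Longrightarrow> 0 < C i \<and> C i < 1" "u \<in> admissible A B"
    "euler_lagrange_solution k (A \<union> B) ((A \<union> B) - closure (A \<inter> B)) f u"
    "is_arg_min (energy k (A \<union> B) f) (\<lambda>w. w \<in> admissible A B) u"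
    "\<And>i x. i \<in> I \<Longrightarrow> x \<in> {p i..q i} \<Longrightarrow>
       u x = integral {p i..x} (\<lambda>t. slope k (\<sigma> i * (C i - integral {p i..t} (g i))))"
proof -
  have "\<exists>C. 0 < C \<and> C < 1 \<and> integral {p i..q i} (\<lambda>t. slope k (C - integral {p i..t} (g i))) = 0" if "i \<in> I" for i
    by (rule exists_balanced_flux[OF k pq[OF that] g[OF that] pos[OF that] le1[OF that]])
  then obtain C where C: "\<And>i. i \<in> I \<Longrightarrow> 0 < C i \<and> C i < 1"
    "\<And>i. i \<in> I \<Longrightarrow> integral {p i..q i} (\<lambda>t. slope k (C i - integral {p i..t} (g i))) = 0"
    by metis
  define \<psi> where "\<psi> i t = \<sigma> i * (C i - integral {p i..t} (g i))" for i t
  define idx where "idx x = (SOME i. i \<in> I \<and> x \<in> {p i<..<q i})" for x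
  define V where "V = (A \<union> B) - closure (A \<inter> B)"
  define \<Psi> where "\<Psi> x = (if x \<in> V then \<psi> (idx x) x else 0)" for x
  define u where "u x = (if x \<in> V then integral {p (idx x)..x} (\<lambda>t. slope k (\<psi> (idx x) t)) else 0)" for x
  have idx: "idx x = i" if "i \<in> I" "x \<in> {p i<..<q i}" for i x
    unfolding idx_def using that disj by (intro some_equality) blast+
  have inV: "x \<in> V" if "i \<in> I" "x \<in> {p i<..<q i}" for i x
    using that V by (auto simp: V_def)
  have bal: "integral {p i..q i} (\<lambda>t. slope k (\<psi> i t)) = 0" if "i \<in> I" for i
  proof -
    have "slope k (\<psi> i t) = \<sigma> i * slope k (C i - integral {p i..t} (g i))" for t
      using \<sigma>[OF that] slope_minus[of k "C i - integral {p i..t} (g i)"] by (auto simp: \<psi>_def)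
    then show ?thesis
      using C(2)[OF that] by simp
  qed
  have ends: "p i \<notin> V" "q i \<notin> V" if i: "i \<in> I" for i
    unfolding V_def V by (rule disjoint_intervals_endpoints[where I=I, OF pq disj i]; assumption)+
  \<comment> \<open>At the left end both sides are trivially 0; at the right end the formula is the
    balance condition \<open>bal\<close>.\<close>
  have u: "u x = integral {p i..x} (\<lambda>t. slope k (\<psi> i t))" if i: "i \<in> I" and x: "x \<in> {p i..q i}" for i x
  proof -
    consider "x = p i" | "x = q i" | "x \<in> {p i<..<q i}"
      using x by fastforce
    then show ?thesis
    proof cases
      case 1
      then show ?thesis using ends(1)[OF i] by (simp add: u_def)
    next
      case 2
      then show ?thesis using ends(2)[OF i] bal[OF i] by (simp add: u_def)
    next
      case 3
      then show ?thesis using idx[OF i 3] inV[OF i 3] by (simp add: u_def)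
    qed
  qed
  interpret flux_pieces A B V f u \<Psi> k I p q "\<lambda>i x. \<sigma> i * g i x" \<psi> "A \<union> B"
  proof unfold_locales
    fix i x assume i: "i \<in> I" and x: "x \<in> {p i..q i}"
    have "((\<lambda>t. integral {p i..t} (g i)) has_real_derivative g i x) (at x within {p i..q i})"
      by (rule integral_has_real_derivative[OF g[OF i] x])
    then show "(\<psi> i has_real_derivative - (\<sigma> i * g i x)) (at x within {p i..q i})"
      unfolding \<psi>_def[abs_def] by (auto intro!: derivative_eq_intros)
    have "0 \<le> integral {p i..x} (g i)" "integral {p i..x} (g i) \<le> 1"
      using integral_positive_mono[OF g[OF i] pos[OF i], of "p i" x] le1[OF i] x by auto
    then show "\<bar>\<psi> i x\<bar> \<le> 1"
      using \<sigma>[OF i] C(1)[OF i] by (auto simp: \<psi>_def)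
  qed (use assms idx inV u in \<open>auto simp: V_def \<Psi>_def u_def intro!: continuous_intros\<close>)
  show ?thesis
    using that[OF C(1) u_admissible euler_lagrange[unfolded V_def] u_minimizer u[unfolded \<psi>_def]] .
qed

section \<open>Interval data and assembly of the solution\<close>

lemma open_interval_cases:
  fixes S :: "real set"
  assumes "open S" "connected S" "bounded S" "S \<noteq> {}"
  obtains a b where "a < b" "S = {a<..<b}"
proof -
  have S: "bdd_above S" "bdd_below S"
    using assms(3) by (auto simp: bounded_imp_bdd_above bounded_imp_bdd_below)
  have "S = {Inf S<..<Sup S}"
  proof
    show "S \<subseteq> {Inf S<..<Sup S}"
    proof
      fix x assume "x \<in> S"
      then obtain e where e: "e > 0" "cball x e \<subseteq> S"
        using assms(1) open_contains_cball by blast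
      then have "x - e \<in> S" "x + e \<in> S"
        by (auto simp: cball_def dist_real_def subset_iff)
      then show "x \<in> {Inf S<..<Sup S}"
        using e(1) cInf_lower[OF _ S(2), of "x - e"] cSup_upper[OF _ S(1), of "x + e"] by auto
    qed
    show "{Inf S<..<Sup S} \<subseteq> S"
    proof
      fix x assume "x \<in> {Inf S<..<Sup S}"
      then obtain y z where "y \<in> S" "y < x" "z \<in> S" "x < z"
        using less_cSup_iff[OF assms(4) S(1), of x] cInf_less_iff[OF assms(4) S(2), of x] by auto
      then show "x \<in> S"
        using connectedD_interval[OF assms(2), of y z x] by simp
    qed
  qed
  then show ?thesis
    using that[of "Inf S" "Sup S"] assms(4) by (metis greaterThanLessThan_empty_iff not_le)
qed

lemma LINT_open_interval:
  fixes g :: "real \<Rightarrow> real"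
  assumes "continuous_on {a..b} g"
  shows "(LINT x:{a<..<b}|lebesgue. g x) = integral {a..b} g"
  using set_lebesgue_integral_eq_integral(2)[OF absolutely_integrable_continuous_real[OF assms, unfolded absolutely_integrable_on_Icc_iff_Ioo]]
  by (simp add: integral_open_interval_real)

lemma LINT_closed_interval:
  fixes g :: "real \<Rightarrow> real"
  assumes "continuous_on {a..b} g" "x \<le> b"
  shows "(LINT x:{a..x}|lebesgue. g x) = integral {a..x} g"
  using set_lebesgue_integral_eq_integral(2)[OF absolutely_integrable_continuous_real[OF continuous_on_subset[OF assms(1)]]]
    assms(2) by simp

text \<open>The construction works with gauge integrals, the final formula with Lebesgue integrals.
  They agree here because both integrands are continuous; for the outer one this needs the flux to
  stay in [-1, 1].\<close>

lemma LINT_slope: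
  fixes g :: "real \<Rightarrow> real"
  assumes k: "k \<ge> 1" and g: "continuous_on {a..b} g" and pos: "\<And>x. x \<in> {a<..<b} \<Longrightarrow> g x > 0"
    and le1: "integral {a..b} g \<le> 1" and C: "0 < C" "C < 1" and x: "x \<in> {a..b}" and \<sigma>: "\<sigma> \<in> {1, -1}"
  shows "integral {a..x} (\<lambda>t. slope k (\<sigma> * (C - integral {a..t} g))) =
    (LINT t:{a..x}|lebesgue. slope k (\<sigma> * (C - (LINT s:{a..t}|lebesgue. g s))))"
proof -
  have c: "continuous_on {a..b} (\<lambda>t. slope k (\<sigma> * (C - integral {a..t} g)))"
  proof (rule continuous_on_compose2[OF slope_continuous_on[OF k]])
    show "continuous_on {a..b} (\<lambda>t. \<sigma> * (C - integral {a..t} g))"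
      by (intro continuous_intros indefinite_integral_continuous_1 integrable_continuous_real g)
    show "(\<lambda>t. \<sigma> * (C - integral {a..t} g)) ` {a..b} \<subseteq> {-1..1}"
    proof clarify
      fix t assume t: "t \<in> {a..b}"
      have "0 \<le> integral {a..t} g" "integral {a..t} g \<le> 1"
        using integral_positive_mono[OF g pos, of a t] t le1 by auto
      then show "\<sigma> * (C - integral {a..t} g) \<in> {-1..1}"
        using C \<sigma> by auto
    qed
  qed
  have "(LINT t:{a..x}|lebesgue. slope k (\<sigma> * (C - (LINT s:{a..t}|lebesgue. g s)))) =
      (LINT t:{a..x}|lebesgue. slope k (\<sigma> * (C - integral {a..t} g)))"
    using x by (intro set_lebesgue_integral_cong) (auto simp: LINT_closed_interval[OF g])
  also have "\<dots> = integral {a..x} (\<lambda>t. slope k (\<sigma> * (C - integral {a..t} g)))"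
    using x by (intro LINT_closed_interval[OF c]) auto
  finally show ?thesis by simp
qed

lemma exists_solution_intervals:
  fixes a b c d :: real and fp fm :: "real \<Rightarrow> real"
  assumes k: "k \<ge> 1" and ab: "a < b" and cd: "c < d"
    and fp: "continuous_on {a..b} fp" "\<And>x. x \<in> {a<..<b} \<Longrightarrow> fp x > 0" "integral {a..b} fp = 1"
    and fm: "continuous_on {c..d} fm" "\<And>x. x \<in> {c<..<d} \<Longrightarrow> fm x > 0" "integral {c..d} fm = 1"
  defines "A \<equiv> {a<..<b}" and "B \<equiv> {c<..<d}"
  shows "\<exists>u C D. 
       u \<in> admissible A B \<and>
       euler_lagrange_solution k (A \<union> B) ((A \<union> B) - closure (A \<inter> B)) (source A B fp fm) u \<and>
       is_arg_min (energy k (A \<union> B) (source A B fp fm)) (\<lambda>w. w \<in> admissible A B) u \<and>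
       (A \<inter> B = {} \<longrightarrow> 0 < C \<and> C < 1 \<and> 0 < D \<and> D < 1 \<and>
         (\<forall>x\<in>{a..b}. u x = (LINT t:{a..x}|lebesgue. slope k (- (LINT s:{a..t}|lebesgue. fp s) + C))) \<and>
         (\<forall>x\<in>{c..d}. u x = (LINT t:{c..x}|lebesgue. slope k ((LINT s:{c..t}|lebesgue. fm s) - D))))"
proof -
  have cl: "closure A = {a..b}" "closure B = {c..d}"
    using ab cd by (simp_all add: A_def B_def)
  show ?thesis
  proof (cases "A \<inter> B = {}")
    case True
    \<comment> \<open>The intervals may touch, but each open interval still misses the closure of
      the other, so \<open>source\<close> is a single density on each piece.\<close>
    then have sep: "b \<le> c \<or> d \<le> a"
      using ab cd dense[of "max a c" "min b d"] unfolding A_def B_def by fastforce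
    \<comment> \<open>\<open>True\<close> stands for \<open>A\<close>, \<open>False\<close> for
      \<open>B\<close>. On \<open>B\<close> the sign -1 turns the flux into the primitive of
      \<open>fm\<close> minus its constant, as in the second formula.\<close>
    define p where "p i = (if i then a else c)" for i
    define q where "q i = (if i then b else d)" for i
    define \<sigma> where "\<sigma> i = (if i then 1 else -1 :: real)" for i
    define g where "g i = (if i then fp else fm)" for i
    obtain u C where uC: "\<And>i. i \<in> (UNIV :: bool set) \<Longrightarrow> 0 < C i \<and> C i < 1" "u \<in> admissible A B"
      "euler_lagrange_solution k (A \<union> B) ((A \<union> B) - closure (A \<inter> B)) (source A B fp fm) u"
      "is_arg_min (energy k (A \<union> B) (source A B fp fm)) (\<lambda>w. w \<in> admissible A B) u"
      "\<And>i x. i \<in> (UNIV :: bool set) \<Longrightarrow> x \<in> {p i..q i} \<Longrightarrow>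
         u x = integral {p i..x} (\<lambda>t. slope k (\<sigma> i * (C i - integral {p i..t} (g i))))"
    proof (rule exists_obstacle_solution[of k A B "UNIV :: bool set" p q g \<sigma> "source A B fp fm"])
      show "A \<union> B - closure (A \<inter> B) = (\<Union>i\<in>UNIV. {p i<..<q i})"
        using True by (auto simp: UNIV_bool p_def q_def A_def B_def)
      show "{p i<..<q i} \<inter> {p j<..<q j} = {}" if "i \<noteq> j" for i j
        using that sep by (cases i; cases j) (auto simp: p_def q_def)
      show "source A B fp fm x = \<sigma> i * g i x" if "x \<in> {p i<..<q i}" for i x
      proof (cases i)
        case True
        then have "x \<in> {a..b}" "x \<notin> {c..d}"
          using that sep by (auto simp: p_def q_def)
        then show ?thesis
          using True by (auto simp: source_def cl \<sigma>_def g_def)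
      next
        case False
        then have "x \<notin> {a..b}" "x \<in> {c..d}"
          using that sep by (auto simp: p_def q_def)
        then show ?thesis
          using False by (auto simp: source_def cl \<sigma>_def g_def)
      qed
    qed (use k ab cd fp fm in \<open>auto simp: A_def B_def p_def q_def g_def \<sigma>_def\<close>)
    have "u x = (LINT t:{a..x}|lebesgue. slope k (- (LINT s:{a..t}|lebesgue. fp s) + C True))" if "x \<in> {a..b}" for x
      using uC(5)[of True x] LINT_slope[OF k fp(1,2), of "C True" x 1] uC(1)[of True] that fp(3)
      by (simp add: p_def q_def \<sigma>_def g_def)
    moreover have "u x = (LINT t:{c..x}|lebesgue. slope k ((LINT s:{c..t}|lebesgue. fm s) - C False))" if "x \<in> {c..d}" for x
      using uC(5)[of False x] LINT_slope[OF k fm(1,2), of "C False" x "-1"] uC(1)[of False] that fm(3)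
      by (simp add: p_def q_def \<sigma>_def g_def)
    ultimately show ?thesis
      using uC(1)[of True] uC(1)[of False] uC(2-4) by (intro exI[of _ u] exI[of _ "C True"] exI[of _ "C False"]) simp
  next
    case False
    then have ov: "max a c < min b d"
      by (auto simp: A_def B_def)
    \<comment> \<open>\<open>True\<close> is the gap between the two left ends, \<open>False\<close>
      the gap between the two right ends. \<open>s\<close> tells whether the gap belongs to
      \<open>A\<close>, and \<open>I\<close> discards empty gaps.\<close>
    define p where "p i = (if i then min a c else min b d)" for i
    define q where "q i = (if i then max a c else max b d)" for i
    define s where "s i = (if i then a < c else d < b)" for i
    define \<sigma> where "\<sigma> i = (if s i then 1 else -1 :: real)" for i
    define g where "g i = (if s i then fp else fm)" for i
    define I where "I = {i. p i < q i}"
    \<comment> \<open>Each gap lies in one domain and misses the closure of the other. So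
      \<open>source\<close> is a single signed density there, with mass at most that of its whole
      domain, which is 1.\<close>
    have piece: "if s i then {p i<..<q i} \<subseteq> {a<..<b} \<and> {p i..q i} \<subseteq> {a..b} \<and> {p i<..<q i} \<inter> {c..d} = {} 
        else {p i<..<q i} \<subseteq> {c<..<d} \<and> {p i..q i} \<subseteq> {c..d} \<and> {p i<..<q i} \<inter> {a..b} = {}" if "i \<in> I" for i
      using that ov by (cases i) (auto simp: I_def p_def q_def s_def min_def max_def split: if_splits)
    have pq: "p i < q i" if "i \<in> I" for i
      using that by (simp add: I_def)
    obtain u where u: "u \<in> admissible A B"
      "euler_lagrange_solution k (A \<union> B) ((A \<union> B) - closure (A \<inter> B)) (source A B fp fm) u"
      "is_arg_min (energy k (A \<union> B) (source A B fp fm)) (\<lambda>w. w \<in> admissible A B) u"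
    proof (rule exists_obstacle_solution[of k A B I p q g \<sigma> "source A B fp fm"])
      have "A \<inter> B = {max a c<..<min b d}"
        by (auto simp: A_def B_def)
      then have "closure (A \<inter> B) = {max a c..min b d}"
        using ov by (simp del: max_less_iff_conj min_less_iff_conj)
      moreover have "(\<Union>i\<in>I. {p i<..<q i}) = {min a c<..<max a c} \<union> {min b d<..<max b d}"
      proof -
        have "(\<Union>i\<in>I. {p i<..<q i}) = (\<Union>i. {p i<..<q i})"
        proof
          show "(\<Union>i. {p i<..<q i}) \<subseteq> (\<Union>i\<in>I. {p i<..<q i})"
          proof
            fix x assume "x \<in> (\<Union>i. {p i<..<q i})"
            then obtain i where "x \<in> {p i<..<q i}" by blast
            then show "x \<in> (\<Union>i\<in>I. {p i<..<q i})"
              by (intro UN_I[of i]) (auto simp: I_def)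
          qed
        qed blast
        then show ?thesis
          by (simp add: UNIV_bool p_def q_def Un_commute)
      qed
      ultimately show "A \<union> B - closure (A \<inter> B) = (\<Union>i\<in>I. {p i<..<q i})"
        using ov by (auto simp: A_def B_def)
      show "{p i<..<q i} \<inter> {p j<..<q j} = {}" if "i \<noteq> j" for i j
        using that ov by (cases i; cases j) (auto simp: p_def q_def)
      show "source A B fp fm x = \<sigma> i * g i x" if "i \<in> I" "x \<in> {p i<..<q i}" for i x
        using piece[OF that(1)] that(2)
        by (cases "s i") (auto simp: source_def cl \<sigma>_def g_def)
      show "continuous_on {p i..q i} (g i)" if "i \<in> I" for i
        using piece[OF that] fp(1) fm(1) by (auto simp: g_def intro: continuous_on_subset)
      show "g i x > 0" if "i \<in> I" "x \<in> {p i<..<q i}" for i x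
        using piece[OF that(1)] that(2) fp(2) fm(2) by (auto simp: g_def split: if_splits)
      show "integral {p i..q i} (g i) \<le> 1" if "i \<in> I" for i
        using piece[OF that] pq[OF that] integral_positive_mono(2)[OF fp(1,2), of "p i" "q i"]
          integral_positive_mono(2)[OF fm(1,2), of "p i" "q i"] fp(3) fm(3)
        by (auto simp: g_def split: if_splits)
    qed (use k pq in \<open>auto simp: A_def B_def \<sigma>_def\<close>)
    then show ?thesis
      using False by blast
  qed
qed

theorem theorem1p1:
  fixes \<Omega> \<Omega>' :: "real set" and fp fm :: "real \<Rightarrow> real"
  assumes "open \<Omega>" "connected \<Omega>" "bounded \<Omega>" "\<Omega> \<noteq> {}"
    and "open \<Omega>'" "connected \<Omega>'" "bounded \<Omega>'" "\<Omega>' \<noteq> {}"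
    and "continuous_on (closure \<Omega>) fp" "\<forall>x\<in>\<Omega>. fp x > 0"
    and "continuous_on (closure \<Omega>') fm" "\<forall>x\<in>\<Omega>'. fm x > 0"
    and "(LINT x:\<Omega>|lebesgue. fp x) = 1" "(LINT x:\<Omega>'|lebesgue. fm x) = 1"
  shows "\<exists>u :: nat \<Rightarrow> real \<Rightarrow> real.
    (\<forall>k\<ge>1.
       u k \<in> admissible \<Omega> \<Omega>' \<and>
       euler_lagrange_solution k (\<Omega> \<union> \<Omega>') ((\<Omega> \<union> \<Omega>') - closure (\<Omega> \<inter> \<Omega>')) (source \<Omega> \<Omega>' fp fm) (u k) \<and>
       is_arg_min (energy k (\<Omega> \<union> \<Omega>') (source \<Omega> \<Omega>' fp fm)) (\<lambda>w. w \<in> admissible \<Omega> \<Omega>') (u k)) \<and>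
    (\<forall>a b c d. \<Omega> = {a<..<b} \<and> \<Omega>' = {c<..<d} \<and> \<Omega> \<inter> \<Omega>' = {} \<longrightarrow>
       (let Fp = (\<lambda>x. LINT t:{a..x}|lebesgue. fp t);
            Fm = (\<lambda>x. LINT t:{c..x}|lebesgue. fm t)
        in \<exists>C D :: nat \<Rightarrow> real. \<forall>k\<ge>1.
             0 < C k \<and> C k < 1 \<and> 0 < D k \<and> D k < 1 \<and>
             (\<forall>x\<in>{a..b}. u k x =
                (LINT t:{a..x}|lebesgue. (- Fp t + C k) / E_inv k ((- Fp t + C k)\<^sup>2))) \<and>
             (\<forall>x\<in>{c..d}. u k x =
                (LINT t:{c..x}|lebesgue. (Fm t - D k) / E_inv k ((Fm t - D k)\<^sup>2)))))"
proof -
  obtain a b where ab: "a < b" "\<Omega> = {a<..<b}"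
    using open_interval_cases[OF assms(1-4)] .
  obtain c d where cd: "c < d" "\<Omega>' = {c<..<d}"
    using open_interval_cases[OF assms(5-8)] .
  have fp: "continuous_on {a..b} fp" "\<And>x. x \<in> {a<..<b} \<Longrightarrow> fp x > 0"
    using assms(9,10) ab by auto
  have fm: "continuous_on {c..d} fm" "\<And>x. x \<in> {c<..<d} \<Longrightarrow> fm x > 0"
    using assms(11,12) cd by auto
  have int: "integral {a..b} fp = 1" "integral {c..d} fm = 1"
    using assms(13,14) LINT_open_interval[OF fp(1)] LINT_open_interval[OF fm(1)] by (simp_all add: ab cd)
  define P where "P k u C D \<longleftrightarrow>
       u \<in> admissible \<Omega> \<Omega>' \<and>
       euler_lagrange_solution k (\<Omega> \<union> \<Omega>') ((\<Omega> \<union> \<Omega>') - closure (\<Omega> \<inter> \<Omega>')) (source \<Omega> \<Omega>' fp fm) u \<and>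
       is_arg_min (energy k (\<Omega> \<union> \<Omega>') (source \<Omega> \<Omega>' fp fm)) (\<lambda>w. w \<in> admissible \<Omega> \<Omega>') u \<and>
       (\<Omega> \<inter> \<Omega>' = {} \<longrightarrow> 0 < C \<and> C < 1 \<and> 0 < D \<and> D < 1 \<and>
         (\<forall>x\<in>{a..b}. u x = (LINT t:{a..x}|lebesgue. slope k (- (LINT s:{a..t}|lebesgue. fp s) + C))) \<and>
         (\<forall>x\<in>{c..d}. u x = (LINT t:{c..x}|lebesgue. slope k ((LINT s:{c..t}|lebesgue. fm s) - D))))"
    for k u C D
  \<comment> \<open>With the premise on \<open>k\<close> inside the existential, choice gives total
    sequences, and the same constants are tied to the function already chosen.\<close>
  have "\<forall>k. \<exists>u C D. k \<ge> 1 \<longrightarrow> P k u C D"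
    unfolding P_def ab(2) cd(2)
    using exists_solution_intervals[OF _ ab(1) cd(1) fp int(1) fm int(2)] by blast
  then obtain u C D where "\<And>k. k \<ge> 1 \<Longrightarrow> P k (u k) (C k) (D k)"
    by metis
  note u = this[unfolded P_def]
  \<comment> \<open>The representation quantifies over its own endpoints, after the functions are
    fixed; a nonempty open interval determines them.\<close>
  have ends: "a' = a \<and> b' = b \<and> c' = c \<and> d' = d"
    if "\<Omega> = {a'<..<b'}" "\<Omega>' = {c'<..<d'}" for a' b' c' d'
  proof -
    have "{a..b} = {a'..b'}" "{c..d} = {c'..d'}"
      using that ab cd by (metis closure_greaterThanLessThan greaterThanLessThan_empty_iff not_le)+
    then show ?thesis
      using ab(1) cd(1) by (auto simp: Icc_eq_Icc)
  qed
  show ?thesis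
  proof (intro exI[of _ u] conjI allI impI, goal_cases)
    case (4 a' b' c' d')
    then have e: "a' = a" "b' = b" "c' = c" "d' = d" and disj: "\<Omega> \<inter> \<Omega>' = {}"
      using ends[of a' b' c' d'] by auto
    show ?case
      unfolding Let_def e slope_def[symmetric] using u disj by blast
  qed (use u in blast)+
qed

end
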